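(* Let $d\ge1$, $\boldsymbol r\in\mathbb N^d$, $J\in\mathbb N$, $R>0$, $\boldsymbol\sigma=(\sigma_1,\dots,\sigma_d)\in\prod_{l=1}^d(0,r_l+1)$, $0<p<\infty$ and $1\le q\le\infty$ be such that $$H(\boldsymbol\sigma)/d>(1/p-1/q)_+ .$$ Let $p'=\infty$ if $0<p\le1$ or $p\ge q$, and $p'=p$ if $1<p<q$, and assume that $s\in\mathcal S(\boldsymbol r,\boldsymbol\sigma,p,p',R)$. Then, for all $k\in\mathbb N$, there exists a partition $m$ of $[0,1]^d$ (which may depend on $s,d,\boldsymbol r,\boldsymbol\sigma,p$ and $q$) that only contains dyadic rectangles with sidelength at least $2^{-J\underline{\boldsymbol\sigma}/\sigma_l}$ in the $l$-th direction, $l=1,\dots,d$, and satisfies both $$|m|\le C_1(d,\boldsymbol\sigma,p)\,2^{kd}$$ and $$\inf_{t\in S_{(m,\boldsymbol r)}}\|s-t\|_q\le C_3(d,\boldsymbol r,\boldsymbol\sigma,p,q)\,R\left(2^{-Jd\left(H(\boldsymbol\sigma)/d-(1/p-1/q)_+\right)\underline{\boldsymbol\sigma}/H(\boldsymbol\sigma)}+2^{-kH(\boldsymbol\sigma)}\right),$$ where $C_1(d,\boldsymbol\sigma,p)$ and $C_3(d,\boldsymbol r,\boldsymbol\sigma,p,q)$ are positive reals that depend only on the parameters indicated.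
   Context: $\mathbb N=\{0,1,2,\dots\}$ and $(x)_+=\max\{x,0\}$. A dyadic rectangle of $[0,1]^d$ is a product $I_1\times\dots\times I_d$ where, for each $l$, $I_l=[0,2^{-j_l}]$ or $I_l=(k_l2^{-j_l},(k_l+1)2^{-j_l}]$ with $j_l\in\mathbb N$, $k_l\in\{1,\dots,2^{j_l}-1\}$. For a partition $m$ of $[0,1]^d$ into (finitely many) dyadic rectangles, $|m|$ is the number of rectangles in $m$, and $S_{(m,\boldsymbol r)}$ is the space of functions on $[0,1]^d$ which, on each rectangle of $m$, are polynomial of degree $\le r_l$ in the $l$-th variable, $l=1,\dots,d$. For $0<p\le\infty$, $\mathbb L_p([0,1]^d)$ is the space of real measurable functions with finite Lebesgue (quasi-)norm $\|\cdot\|_p$ (essential supremum if $p=\infty$), functions being identified when equal almost everywhere. For $\boldsymbol\sigma\in(0,\infty)^d$: $\underline{\boldsymbol\sigma}=\min_l\sigma_l$ and $H(\boldsymbol\sigma)=\big(\frac1d\sum_{l=1}^d\frac1{\sigma_l}\big)^{-1}$. For $j\in\mathbb N$, $\mathcal D_j^{\boldsymbol\sigma}$ is the set of all dyadic rectangles $I_1\times\dots\times I_d$ such that each $I_l$ has length $2^{-\lfloor j\underline{\boldsymbol\sigma}/\sigma_l\rfloor}$; it is a partition of $[0,1]^d$. $\Pi_k^{\boldsymbol r,\boldsymbol\sigma}$ is the set of functions on $[0,1]^d$ that are polynomial of degree $\le r_l$ in the $l$-th variable over each rectangle of $\mathcal D_k^{\boldsymbol\sigma}$. For $s\in\mathbb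 L_p([0,1]^d)$, $$e_{\boldsymbol r,\boldsymbol\sigma,p,k}(s)=\inf_{P\in\Pi_k^{\boldsymbol r,\boldsymbol\sigma}}\|s-P\|_p,$$ $$N_{\boldsymbol r,\boldsymbol\sigma,p,p'}(s)=\Big(\sum_{k\in\mathbb N}(2^{k\underline{\boldsymbol\sigma}}e_{\boldsymbol r,\boldsymbol\sigma,p,k}(s))^{p'}\Big)^{1/p'}\ (0<p'<\infty),\qquad N_{\boldsymbol r,\boldsymbol\sigma,p,\infty}(s)=\sup_{k\in\mathbb N}2^{k\underline{\boldsymbol\sigma}}e_{\boldsymbol r,\boldsymbol\sigma,p,k}(s),$$ and $\mathcal S(\boldsymbol r,\boldsymbol\sigma,p,p',R)=\{s\in\mathbb L_p([0,1]^d): N_{\boldsymbol r,\boldsymbol\sigma,p,p'}(s)\le R\}$. *)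

theory Defs
  imports "HOL-Probability.Essential_Supremum" "HOL-Library.Disjoint_Sets"
begin

text \<open>Points of the unit cube live in \<^typ>\<open>real ^ 'n\<close>, so the dimension is \<open>CARD('n)\<close>; multi-indices and
  smoothness vectors are functions on the index type. A dyadic rectangle is given by
  its levels \<open>j\<close> (its sidelength in direction \<open>l\<close> is \<open>(1/2) ^ j l\<close>) and its positions.\<close>

definition dyadic_interval :: "nat \<Rightarrow> nat \<Rightarrow> real set" where
  "dyadic_interval j k =
     (if k = 0 then {0 .. (1/2) ^ j} else {real k * (1/2) ^ j <.. (real k + 1) * (1/2) ^ j})"

definition dyadic_rectangles :: "('n::finite \<Rightarrow> nat) \<Rightarrow> (real ^ 'n) set set" where
  "dyadic_rectangles j =
     {{x. \<forall>l. x $ l \<in> dyadic_interval (j l) (k l)} | k. \<forall>l. k l < 2 ^ j l}"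

definition min_smoothness :: "('n::finite \<Rightarrow> real) \<Rightarrow> real" where
  "min_smoothness \<sigma> = Min (range \<sigma>)"

definition harmonic_mean :: "('n::finite \<Rightarrow> real) \<Rightarrow> real" where
  "harmonic_mean \<sigma> = inverse (1 / real CARD('n) * (\<Sum>l\<in>UNIV. 1 / \<sigma> l))"

definition aniso_partition :: "('n::finite \<Rightarrow> real) \<Rightarrow> nat \<Rightarrow> (real ^ 'n) set set" where
  "aniso_partition \<sigma> j = dyadic_rectangles (\<lambda>l. nat \<lfloor>real j * min_smoothness \<sigma> / \<sigma> l\<rfloor>)"

text \<open>Values outside \<open>\<Union>m\<close> are irrelevant: all norms below are taken over the unit cube.\<close>

definition piecewise_poly ::
    "('n::finite \<Rightarrow> nat) \<Rightarrow> (real ^ 'n) set set \<Rightarrow> (real ^ 'n \<Rightarrow> real) set" where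
  "piecewise_poly r m =
     {f. \<forall>I\<in>m. \<exists>c :: ('n \<Rightarrow> nat) \<Rightarrow> real. \<forall>x\<in>I.
           f x = (\<Sum>a | \<forall>l. a l \<le> r l. c a * (\<Prod>l\<in>UNIV. (x $ l) ^ a l))}"

definition ennreal_powr :: "ennreal \<Rightarrow> real \<Rightarrow> ennreal" where
  "ennreal_powr x a = (if x = \<infinity> then \<infinity> else ennreal (enn2real x powr a))"

definition Lp_norm :: "'a measure \<Rightarrow> ennreal \<Rightarrow> ('a \<Rightarrow> real) \<Rightarrow> ennreal" where
  "Lp_norm M p f =
     (if p = \<infinity> then esssup M (\<lambda>x. ennreal \<bar>f x\<bar>)
      else ennreal_powr (\<integral>\<^sup>+ x. ennreal (\<bar>f x\<bar> powr enn2real p) \<partial>M) (1 / enn2real p))"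

abbreviation cube_measure :: "(real ^ 'n::finite) measure" where
  "cube_measure \<equiv> lebesgue_on (cbox 0 1)"

definition Lp_cube :: "ennreal \<Rightarrow> (real ^ 'n::finite \<Rightarrow> real) set" where
  "Lp_cube p = {f \<in> borel_measurable cube_measure. Lp_norm cube_measure p f < \<infinity>}"

definition approx_error ::
    "('n::finite \<Rightarrow> nat) \<Rightarrow> ennreal \<Rightarrow> (real ^ 'n) set set \<Rightarrow> (real ^ 'n \<Rightarrow> real) \<Rightarrow> ennreal" where
  "approx_error r p m s = (INF t\<in>piecewise_poly r m. Lp_norm cube_measure p (\<lambda>x. s x - t x))"

definition smoothness_seminorm ::
    "('n::finite \<Rightarrow> nat) \<Rightarrow> ('n \<Rightarrow> real) \<Rightarrow> ennreal \<Rightarrow> ennreal \<Rightarrow> (real ^ 'n \<Rightarrow> real) \<Rightarrow> ennreal" where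
  "smoothness_seminorm r \<sigma> p p' s =
     (let a = (\<lambda>k. ennreal (2 powr (real k * min_smoothness \<sigma>))
                     * approx_error r p (aniso_partition \<sigma> k) s)
      in if p' = \<infinity> then (SUP k. a k)
         else ennreal_powr (\<Sum>k. ennreal_powr (a k) (enn2real p')) (1 / enn2real p'))"

definition smoothness_ball ::
    "('n::finite \<Rightarrow> nat) \<Rightarrow> ('n \<Rightarrow> real) \<Rightarrow> ennreal \<Rightarrow> ennreal \<Rightarrow> real \<Rightarrow> (real ^ 'n \<Rightarrow> real) set" where
  "smoothness_ball r \<sigma> p p' R = {s \<in> Lp_cube p. smoothness_seminorm r \<sigma> p p' s \<le> ennreal R}"

end

theory Submission
  imports Defs
begin

text \<open>Let \<open>P\<^sub>j\<close> be near-best approximations of \<open>s\<close> on the partition of level \<open>j\<close> and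
  \<open>w\<^sub>j = P\<^sub>j - P\<^sub>j\<^sub>-\<^sub>1\<close>, so that \<open>\<parallel>w\<^sub>j\<parallel>\<^sub>p\<close> decays geometrically. On a cell of level
  \<open>j\<close> the function \<open>w\<^sub>j\<close> is a polynomial, so its supremum is controlled by its local \<open>L\<^sub>p\<close> norm.
  For \<open>p < q\<close>, fix \<open>j\<^sub>0\<close> with about \<open>2\<^bsup>kd\<^esup>\<close> cells of level \<open>j\<^sub>0\<close>; for \<open>j\<^sub>0 < j \<le> J\<close> call a cell
  large if the local \<open>L\<^sub>p\<close> norm of \<open>w\<^sub>j\<close> on it exceeds a threshold that allows at most
  \<open>2\<^bsup>kd\<^esup> 2\<^bsup>-\<eta>(j - j\<^sub>0)\<^esup> / K\<close> large cells. The partition \<open>m\<close> consists of the leaves of the smallest tree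
  that has all levels up to \<open>j\<^sub>0\<close> and in which no large cell lies strictly inside a leaf, and the approximant
  is \<open>P\<^sub>i\<close> on a leaf of level \<open>i\<close>. The error then only involves the small cells of levels above
  \<open>j\<^sub>0\<close>, and interpolating between the sup bound and the \<open>L\<^sub>p\<close> bound makes the sum over \<open>j\<close>
  geometric as soon as \<open>\<eta>\<close> is small, because \<open>H/d > 1/p - 1/q\<close>. The summability exponent
  \<open>p'\<close> plays no role beyond \<open>e\<^sub>j \<le> R 2\<^bsup>-j\<mu>\<^esup>\<close> with \<open>\<mu> = min \<sigma>\<^sub>l\<close>. Taking \<open>K\<close>, which only enters
  the error constant, large makes \<open>C1 = 2\<close> possible although \<open>\<eta>\<close> depends on \<open>q\<close>.\<close>

section \<open>Dyadic cells\<close>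

text \<open>The position of the interval of level \<open>j\<close> that holds \<open>x\<close>.
  Truncation by \<open>nat\<close> gives \<open>x = 0\<close> the index 0, in accordance with the
  closed first interval.\<close>

definition dyadic_index :: "nat \<Rightarrow> real \<Rightarrow> nat" where
  "dyadic_index j x = nat (\<lceil>x * 2 ^ j\<rceil> - 1)"

lemma mem_dyadic_interval_iff:
  assumes "0 \<le> x"
  shows "x \<in> dyadic_interval j k \<longleftrightarrow> dyadic_index j x = k"
proof -
  have e: "a \<le> (1/2)^j * b \<longleftrightarrow> a * 2^j \<le> b" "(1/2)^j * b < a \<longleftrightarrow> b < a * 2^j" for a b :: real
    by (simp_all add: power_one_over field_simps)
  have "x \<in> dyadic_interval j k \<longleftrightarrow> (if k = 0 then x * 2^j \<le> 1 else real k < x * 2^j \<and> x * 2^j \<le> real k + 1)"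
    using assms e(1)[of x 1] e(1)[of x "real k + 1"] e(2)[of "real k" x]
    by (auto simp: dyadic_interval_def mult.commute)
  also have "\<dots> \<longleftrightarrow> dyadic_index j x = k"
  proof (cases "k = 0")
    case True
    then show ?thesis by (auto simp: dyadic_index_def ceiling_le_iff)
  next
    case False
    then have "dyadic_index j x = k \<longleftrightarrow> \<lceil>x * 2^j\<rceil> = int k + 1"
      by (auto simp: dyadic_index_def)
    also have "\<dots> \<longleftrightarrow> real k < x * 2^j \<and> x * 2^j \<le> real k + 1"
      by (simp add: ceiling_eq_iff)
    finally show ?thesis using False by simp
  qed
  finally show ?thesis .
qed

text \<open>Nestedness in index form: for \<open>y = x * 2 ^ j\<close> the ceiling of
  \<open>2 * y\<close> is twice the ceiling of \<open>y\<close> or one less, and both values give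
  the same result after subtracting 1 and halving.\<close>

lemma dyadic_index_Suc: "dyadic_index j x = dyadic_index (Suc j) x div 2"
proof -
  define y where "y = x * 2 ^ j"
  have "\<lceil>y\<rceil> - 1 = (\<lceil>2 * y\<rceil> - 1) div 2"
  proof -
    have "\<lceil>2*y\<rceil> = 2 * \<lceil>y\<rceil> \<or> \<lceil>2*y\<rceil> = 2 * \<lceil>y\<rceil> - 1"
      by linarith
    then show ?thesis by auto
  qed
  then show ?thesis
    unfolding dyadic_index_def y_def
    by (simp add: mult_ac nat_div_distrib')
qed

lemma dyadic_index_eq_mono:
  assumes "i \<le> j" "dyadic_index j x = dyadic_index j y"
  shows "dyadic_index i x = dyadic_index i y"
  using assms
proof (induction j rule: dec_induct)
  case (step n)
  then show ?case using dyadic_index_Suc[of n] by metis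
qed auto

lemma dyadic_index_less:
  assumes "x \<le> 1"
  shows "dyadic_index j x < 2 ^ j"
proof -
  have "x * 2 ^ j \<le> 2 ^ j" using assms by simp
  then have "\<lceil>x * 2 ^ j\<rceil> \<le> 2 ^ j" by (simp add: ceiling_le_iff)
  then show ?thesis unfolding dyadic_index_def by (simp add: zless_nat_conj nat_less_eq_zless flip: nat_power_eq)
qed

text \<open>A rectangle is addressed by a point in it, so that cells are fibres of the index map and
  disjointness and nesting follow from equality of indices. Intersection with the cube removes
  points with negative coordinates, whose index is truncated to 0.\<close>

definition dyadic_cell :: "('n::finite \<Rightarrow> nat) \<Rightarrow> real ^ 'n \<Rightarrow> (real ^ 'n) set" where
  "dyadic_cell j x = {y \<in> cbox 0 1. \<forall>l. dyadic_index (j l) (y $ l) = dyadic_index (j l) (x $ l)}"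

lemma dyadic_interval_subset: "k < 2 ^ j \<Longrightarrow> dyadic_interval j k \<subseteq> {0..1}"
proof
  fix x assume k: "k < 2 ^ j" and x: "x \<in> dyadic_interval j k"
  have "real k + 1 \<le> 2 ^ j" using k by (metis Suc_leI of_nat_Suc of_nat_le_iff of_nat_numeral of_nat_power add.commute)
  then have "(real k + 1) * (1/2) ^ j \<le> 1" by (simp add: power_one_over field_simps)
  moreover have "(1/2::real) ^ j \<le> 1" by (simp add: power_le_one)
  moreover have "0 \<le> real k * (1/2) ^ j" by (intro mult_nonneg_nonneg) auto
  moreover have "x \<le> (1/2) ^ j \<and> 0 \<le> x \<or> real k * (1/2) ^ j < x \<and> x \<le> (real k + 1) * (1/2) ^ j"
    using x by (simp add: dyadic_interval_def split: if_splits)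
  ultimately have "0 \<le> x \<and> x \<le> 1" by linarith
  then show "x \<in> {0..1}" by simp
qed

lemma dyadic_rectangle_eq_cell:
  fixes x :: "real ^ 'n::finite"
  assumes "\<And>l. dyadic_index (j l) (x $ l) = k l" "\<And>l. k l < 2 ^ j l"
  shows "{y. \<forall>l. y $ l \<in> dyadic_interval (j l) (k l)} = dyadic_cell j x"
proof -
  have "(\<forall>l. y $ l \<in> dyadic_interval (j l) (k l)) \<longleftrightarrow>
        (\<forall>l. 0 \<le> y $ l \<and> y $ l \<le> 1) \<and> (\<forall>l. y $ l \<in> dyadic_interval (j l) (k l))" for y :: "real ^ 'n"
    using dyadic_interval_subset[OF assms(2)] by (auto simp: subset_iff)
  also have "\<dots> y \<longleftrightarrow> (\<forall>l. 0 \<le> y $ l \<and> y $ l \<le> 1) \<and> (\<forall>l. dyadic_index (j l) (y $ l) = k l)" for y :: "real ^ 'n"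
    using mem_dyadic_interval_iff by blast
  finally show ?thesis
    using assms(1) by (auto simp: dyadic_cell_def mem_box_cart)
qed

lemma dyadic_rectangles_eq: "dyadic_rectangles j = dyadic_cell j ` cbox 0 1"
proof (intro equalityI subsetI)
  fix I assume "I \<in> dyadic_rectangles j"
  then obtain k where I: "I = {x. \<forall>l. x $ l \<in> dyadic_interval (j l) (k l)}" and k: "\<And>l. k l < 2 ^ j l"
    by (auto simp: dyadic_rectangles_def)
  \<comment> \<open>The upper corner serves as base point because right endpoints belong to the
    first interval as well as to the half-open ones.\<close>
  define x :: "real ^ 'a" where "x = (\<chi> l. (real (k l) + 1) * (1/2) ^ j l)"
  have x: "x $ l \<in> dyadic_interval (j l) (k l)" for l
    by (auto simp: x_def dyadic_interval_def)
  then have x01: "0 \<le> x $ l \<and> x $ l \<le> 1" for l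
    using dyadic_interval_subset[OF k] by (auto simp: subset_iff)
  have "dyadic_index (j l) (x $ l) = k l" for l
    using x x01 mem_dyadic_interval_iff by blast
  then have "I = dyadic_cell j x"
    unfolding I by (rule dyadic_rectangle_eq_cell) (rule k)
  then show "I \<in> dyadic_cell j ` cbox 0 1" using x01 by (auto simp: mem_box_cart)
next
  fix I assume "I \<in> dyadic_cell j ` cbox 0 1"
  then obtain x where x: "x \<in> cbox 0 1" "I = dyadic_cell j x" by auto
  then have "\<And>l. dyadic_index (j l) (x $ l) < 2 ^ j l"
    by (intro dyadic_index_less) (auto simp: mem_box_cart)
  with x(2) dyadic_rectangle_eq_cell[of j x "\<lambda>l. dyadic_index (j l) (x $ l)"]
  have "I = {y. \<forall>l. y $ l \<in> dyadic_interval (j l) (dyadic_index (j l) (x $ l))}" by simp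
  with \<open>\<And>l. dyadic_index (j l) (x $ l) < 2 ^ j l\<close> show "I \<in> dyadic_rectangles j"
    unfolding dyadic_rectangles_def by (intro CollectI exI[of _ "\<lambda>l. dyadic_index (j l) (x $ l)"]) auto
qed

lemma dyadic_cell_self: "x \<in> cbox 0 1 \<Longrightarrow> x \<in> dyadic_cell j x"
  by (simp add: dyadic_cell_def)

lemma dyadic_cell_subset: "dyadic_cell j x \<subseteq> cbox 0 1"
  by (auto simp: dyadic_cell_def)

lemma dyadic_cell_eq: "y \<in> dyadic_cell j x \<Longrightarrow> dyadic_cell j y = dyadic_cell j x"
  by (auto simp: dyadic_cell_def)

lemma dyadic_cell_mono:
  assumes "\<And>l. i l \<le> j l"
  shows "dyadic_cell j x \<subseteq> dyadic_cell i x"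
  unfolding dyadic_cell_def using dyadic_index_eq_mono assms by blast

lemma card_dyadic_rectangles:
  "finite (dyadic_rectangles j)" "card (dyadic_rectangles (j :: 'n::finite \<Rightarrow> nat)) \<le> 2 ^ (\<Sum>l\<in>UNIV. j l)"
proof -
  let ?K = "PiE UNIV (\<lambda>l. {..<2 ^ j l :: nat})"
  have eq: "dyadic_rectangles j = (\<lambda>k. {x. \<forall>l. x $ l \<in> dyadic_interval (j l) (k l)}) ` ?K"
    by (auto simp: dyadic_rectangles_def)
  have fin: "finite ?K" by (intro finite_PiE) auto
  then show "finite (dyadic_rectangles j)" unfolding eq by blast
  have "card ?K = 2 ^ (\<Sum>l\<in>UNIV. j l)" by (simp add: card_PiE power_sum)
  then show "card (dyadic_rectangles j) \<le> 2 ^ (\<Sum>l\<in>UNIV. j l)"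
    unfolding eq using card_image_le[OF fin] by metis
qed

text \<open>In each direction the interval is either kept or halved, so a child has at most two
  possible indices there: \<open>d\<close>, or one of \<open>2 * d\<close> and
  \<open>2 * d + 1\<close>.\<close>

lemma card_dyadic_children:
  assumes "\<And>l. i l \<le> j l" "\<And>l. j l \<le> Suc (i l)"
  shows "card (dyadic_cell j ` dyadic_cell i (x :: real ^ 'n::finite)) \<le> 2 ^ CARD('n)"
proof -
  let ?d = "\<lambda>l. dyadic_index (i l) (x $ l)"
  let ?c = "\<lambda>l. if j l = i l then {?d l} else {2 * ?d l, Suc (2 * ?d l)}"
  let ?K = "PiE UNIV ?c"
  let ?F = "\<lambda>k. {y \<in> cbox 0 1. \<forall>l. dyadic_index (j l) (y $ l) = k l} :: (real ^ 'n) set"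
  have fin: "finite ?K" by (intro finite_PiE) auto
  have "dyadic_cell j ` dyadic_cell i x \<subseteq> ?F ` ?K"
  proof
    fix L assume "L \<in> dyadic_cell j ` dyadic_cell i x"
    then obtain y where y: "y \<in> dyadic_cell i x" "L = dyadic_cell j y" by auto
    have "dyadic_index (j l) (y $ l) \<in> ?c l" for l
    proof (cases "j l = i l")
      case True
      then show ?thesis using y(1) by (auto simp: dyadic_cell_def)
    next
      case False
      then have "j l = Suc (i l)" using assms[of l] by auto
      moreover have "dyadic_index (i l) (y $ l) = ?d l" using y(1) by (auto simp: dyadic_cell_def)
      ultimately have "dyadic_index (j l) (y $ l) div 2 = ?d l" using dyadic_index_Suc by metis
      then show ?thesis using False by auto
    qed
    then have "(\<lambda>l. dyadic_index (j l) (y $ l)) \<in> ?K" by (simp only: PiE_UNIV_domain Pi_I)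
    then show "L \<in> ?F ` ?K" unfolding y(2) dyadic_cell_def by (intro image_eqI) simp_all
  qed
  then have "card (dyadic_cell j ` dyadic_cell i x) \<le> card ?K"
    using surj_card_le[OF fin] by blast
  also have "\<dots> = (\<Prod>l\<in>UNIV. card (?c l))" by (simp add: card_PiE)
  also have "\<dots> \<le> (\<Prod>l\<in>(UNIV::'n set). 2)" by (intro prod_mono) auto
  finally show ?thesis by simp
qed

lemma partition_on_dyadic_rectangles: "partition_on (cbox 0 1) (dyadic_rectangles j)"
  unfolding dyadic_rectangles_eq
proof (intro partition_onI)
  fix p p' assume "p \<in> dyadic_cell j ` cbox 0 1" "p' \<in> dyadic_cell j ` cbox 0 1" "p \<noteq> p'"
  then show "disjnt p p'" using dyadic_cell_eq unfolding disjnt_def by blast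
next
  show "{} \<notin> dyadic_cell j ` cbox 0 1" using dyadic_cell_self by fastforce
  show "\<Union> (dyadic_cell j ` cbox 0 1) = cbox 0 1" using dyadic_cell_self dyadic_cell_subset by fastforce
qed

text \<open>Polynomial estimates are stated on boxes, while cells are half-open. The open box will
  be used for the integral and the closed one for the evaluation point.\<close>

lemma dyadic_cell_between_boxes:
  fixes x :: "real ^ 'n::finite"
  assumes "x \<in> cbox 0 1"
  shows "\<exists>a b. (\<forall>l. b $ l - a $ l = (1/2) ^ j l) \<and> box a b \<subseteq> dyadic_cell j x \<and> dyadic_cell j x \<subseteq> cbox a b"
proof (intro exI conjI allI)
  let ?k = "\<lambda>l. dyadic_index (j l) (x $ l)"
  let ?a = "\<chi> l. real (?k l) * (1/2) ^ j l" and ?b = "\<chi> l. (real (?k l) + 1) * (1/2) ^ j l"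
  have k: "?k l < 2 ^ j l" for l using assms by (intro dyadic_index_less) (auto simp: mem_box_cart)
  have eq: "dyadic_cell j x = {y. \<forall>l. y $ l \<in> dyadic_interval (j l) (?k l)}"
    by (subst dyadic_rectangle_eq_cell[OF refl k]) simp
  show "?b $ l - ?a $ l = (1/2) ^ j l" for l by (simp add: algebra_simps)
  show "box ?a ?b \<subseteq> dyadic_cell j x"
  proof
    fix y assume "y \<in> box ?a ?b"
    then have y: "real (?k l) * (1/2) ^ j l < y $ l" "y $ l < (real (?k l) + 1) * (1/2) ^ j l" for l
      by (auto simp: mem_box_cart)
    have "y $ l \<in> dyadic_interval (j l) (?k l)" for l
      using y[of l] by (cases "?k l = 0") (auto simp: dyadic_interval_def)
    then show "y \<in> dyadic_cell j x" unfolding eq by blast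
  qed
  show "dyadic_cell j x \<subseteq> cbox ?a ?b"
    unfolding eq
  proof
    fix y assume "y \<in> {y. \<forall>l. y $ l \<in> dyadic_interval (j l) (?k l)}"
    then have y: "y $ l \<in> dyadic_interval (j l) (?k l)" for l by blast
    have "?a $ l \<le> y $ l \<and> y $ l \<le> ?b $ l" for l
      using y[of l] by (cases "?k l = 0") (auto simp: dyadic_interval_def)
    then show "y \<in> cbox ?a ?b" by (auto simp: mem_box_cart)
  qed
qed

lemma dyadic_cell_borel [measurable]: "dyadic_cell j (x :: real ^ 'n::finite) \<in> sets borel"
proof -
  have "(\<lambda>y. dyadic_index (j l) (y $ l)) \<in> measurable borel (count_space UNIV)" for l :: 'n
    unfolding dyadic_index_def by measurable
  then have "{y \<in> space borel. \<forall>l. dyadic_index (j l) (y $ l) = dyadic_index (j l) (x $ l)} \<in> sets (borel :: (real ^ 'n) measure)"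
    by measurable
  from sets.Int[OF borel_closed[OF closed_cbox] this]
  show ?thesis by (simp add: dyadic_cell_def Int_def)
qed

section \<open>Polynomials on boxes\<close>

text \<open>Polynomials on the whole space, without reference to a piece, so that they can be
  subtracted and evaluated at grid points anywhere.\<close>

definition box_polynomials :: "('n::finite \<Rightarrow> nat) \<Rightarrow> (real ^ 'n \<Rightarrow> real) set" where
  "box_polynomials r = {f. \<exists>c. \<forall>x. f x = (\<Sum>a | \<forall>l. a l \<le> r l. c a * (\<Prod>l\<in>UNIV. (x $ l) ^ a l))}"

lemma piecewise_poly_iff:
  "f \<in> piecewise_poly r m \<longleftrightarrow> (\<forall>I\<in>m. \<exists>g\<in>box_polynomials r. \<forall>x\<in>I. f x = g x)"
proof -
  have "(\<exists>c. \<forall>x\<in>I. f x = (\<Sum>a | \<forall>l. a l \<le> r l. c a * (\<Prod>l\<in>UNIV. (x $ l) ^ a l)))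
     \<longleftrightarrow> (\<exists>g\<in>box_polynomials r. \<forall>x\<in>I. f x = g x)" (is "(\<exists>c. ?P c) \<longleftrightarrow> ?R") for I
  proof
    assume "\<exists>c. ?P c"
    then obtain c where c: "?P c" ..
    have "(\<lambda>x. \<Sum>a | \<forall>l. a l \<le> r l. c a * (\<Prod>l\<in>UNIV. (x $ l) ^ a l)) \<in> box_polynomials r"
      unfolding box_polynomials_def by blast
    with c show ?R by (intro bexI)
  next
    assume ?R
    then show "\<exists>c. ?P c" by (fastforce simp: box_polynomials_def)
  qed
  then show ?thesis by (simp add: piecewise_poly_def)
qed

lemma box_polynomials_diff:
  assumes "f \<in> box_polynomials r" "g \<in> box_polynomials r"
  shows "(\<lambda>x. f x - g x) \<in> box_polynomials r"
proof -
  obtain c where c: "\<And>x. f x = (\<Sum>a | \<forall>l. a l \<le> r l. c a * (\<Prod>l\<in>UNIV. (x $ l) ^ a l))"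
    using assms(1) by (auto simp: box_polynomials_def)
  obtain c' where c': "\<And>x. g x = (\<Sum>a | \<forall>l. a l \<le> r l. c' a * (\<Prod>l\<in>UNIV. (x $ l) ^ a l))"
    using assms(2) by (auto simp: box_polynomials_def)
  show ?thesis unfolding box_polynomials_def
    by (intro CollectI exI[of _ "\<lambda>a. c a - c' a"])
       (simp add: c c' left_diff_distrib sum_subtractf)
qed

lemma borel_measurable_box_polynomial:
  assumes "f \<in> box_polynomials r"
  shows "f \<in> borel_measurable borel"
proof -
  obtain c where c: "\<And>x. f x = (\<Sum>a | \<forall>l. a l \<le> r l. c a * (\<Prod>l\<in>UNIV. (x $ l) ^ a l))"
    using assms by (auto simp: box_polynomials_def)
  show ?thesis unfolding c[abs_def] by measurable
qed

section \<open>Lagrange interpolation and the supremum bound for polynomials on boxes\<close>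

definition lagrange_basis :: "(nat \<Rightarrow> real) \<Rightarrow> nat \<Rightarrow> nat \<Rightarrow> real \<Rightarrow> real" where
  "lagrange_basis t n i x = (\<Prod>j\<in>{..n} - {i}. (x - t j) / (t i - t j))"

text \<open>Both sides are polynomials of degree at most \<open>n\<close> in \<open>x\<close> that
  agree at the \<open>n + 1\<close> distinct nodes.\<close>

lemma lagrange_monomial:
  assumes inj: "inj_on t {..n}" and "a \<le> n"
  shows "x ^ a = (\<Sum>i\<le>n. t i ^ a * lagrange_basis t n i x)"
proof -
  define L where "L i = (\<Prod>j\<in>{..n} - {i}. smult (1 / (t i - t j)) [:- t j, 1:])" for i
  have L: "poly (L i) y = lagrange_basis t n i y" for i y
    by (simp add: L_def poly_prod lagrange_basis_def diff_divide_distrib)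
  have deg: "degree (L i) \<le> n" if "i \<le> n" for i
  proof -
    have "degree (L i) \<le> sum (degree \<circ> (\<lambda>j. smult (1 / (t i - t j)) [:- t j, 1:])) ({..n} - {i})"
      unfolding L_def by (rule degree_prod_sum_le) simp
    also have "\<dots> \<le> sum (\<lambda>_. 1) ({..n} - {i})"
      by (intro sum_mono) simp
    also have "\<dots> = n" using that by simp
    finally show ?thesis .
  qed
  have nodes: "lagrange_basis t n i (t j) = (if i = j then 1 else 0)" if "i \<le> n" "j \<le> n" for i j
  proof (cases "i = j")
    case True
    have "t i - t k \<noteq> 0" if "k \<in> {..n} - {i}" for k
      using inj \<open>i \<le> n\<close> that by (auto dest: inj_onD)
    then show ?thesis using True unfolding lagrange_basis_def by (auto intro: prod.neutral)
  next
    case False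
    then show ?thesis using that unfolding lagrange_basis_def by (auto intro!: prod_zero)
  qed
  have "monom 1 a = (\<Sum>i\<le>n. smult (t i ^ a) (L i))"
  proof (rule poly_eqI_degree[where A = "t ` {..n}"])
    fix y assume "y \<in> t ` {..n}"
    then obtain j where j: "j \<le> n" "y = t j" by auto
    have "(\<Sum>i\<le>n. t i ^ a * lagrange_basis t n i (t j)) = (\<Sum>i\<le>n. if i = j then t i ^ a else 0)"
      using nodes j(1) by (intro sum.cong) auto
    also have "\<dots> = t j ^ a" using j(1) by simp
    finally show "poly (monom 1 a) y = poly (\<Sum>i\<le>n. smult (t i ^ a) (L i)) y"
      by (simp add: poly_monom poly_sum L j)
  next
    have card: "card (t ` {..n}) = Suc n" using inj by (simp add: card_image)
    show "degree (monom (1::real) a) < card (t ` {..n})"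
      using \<open>a \<le> n\<close> degree_monom_le[of "1::real" a] by (simp add: card)
    have "degree (\<Sum>i\<le>n. smult (t i ^ a) (L i)) \<le> n"
      by (intro degree_sum_le) (auto simp: deg)
    then show "degree (\<Sum>i\<le>n. smult (t i ^ a) (L i)) < card (t ` {..n})" by (simp add: card)
  qed
  then have "poly (monom 1 a) x = poly (\<Sum>i\<le>n. smult (t i ^ a) (L i)) x" by simp
  then show ?thesis by (simp add: poly_monom poly_sum L)
qed

text \<open>For a monomial, the product over the directions of the one-dimensional identities
  expands into a sum over the grid. Exchanging this sum with the one over monomials collects the
  coefficients into values of \<open>f\<close> at grid points.\<close>

lemma lagrange_tensor:
  fixes f :: "real ^ 'n::finite \<Rightarrow> real"
  assumes "f \<in> box_polynomials r" and inj: "\<And>l. inj_on (t l) {..r l}"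
  shows "f x = (\<Sum>i\<in>PiE UNIV (\<lambda>l. {..r l}). f (\<chi> l. t l (i l)) *
            (\<Prod>l\<in>UNIV. lagrange_basis (t l) (r l) (i l) (x $ l)))"
proof -
  let ?K = "PiE UNIV (\<lambda>l. {..r l}) :: ('n \<Rightarrow> nat) set"
  let ?B = "\<lambda>i. \<Prod>l\<in>UNIV. lagrange_basis (t l) (r l) (i l) (x $ l)"
  have K: "{a. \<forall>l. a l \<le> r l} = ?K" by (auto simp: PiE_UNIV_domain)
  obtain c where c: "\<And>x. f x = (\<Sum>a\<in>?K. c a * (\<Prod>l\<in>UNIV. (x $ l) ^ a l))"
    using assms(1) unfolding box_polynomials_def K by auto
  have mono: "(\<Prod>l\<in>UNIV. (x $ l) ^ a l) = (\<Sum>i\<in>?K. (\<Prod>l\<in>UNIV. t l (i l) ^ a l) * ?B i)" if "a \<in> ?K" for a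
  proof -
    have "(\<Prod>l\<in>UNIV. (x $ l) ^ a l)
        = (\<Prod>l\<in>UNIV. \<Sum>i\<le>r l. t l i ^ a l * lagrange_basis (t l) (r l) i (x $ l))"
      using that by (intro prod.cong lagrange_monomial inj) auto
    also have "\<dots> = (\<Sum>i\<in>?K. \<Prod>l\<in>UNIV. t l (i l) ^ a l * lagrange_basis (t l) (r l) (i l) (x $ l))"
      by (rule prod_sum_PiE) auto
    finally show ?thesis by (simp add: prod.distrib)
  qed
  have "f x = (\<Sum>a\<in>?K. c a * (\<Sum>i\<in>?K. (\<Prod>l\<in>UNIV. t l (i l) ^ a l) * ?B i))"
    unfolding c[of x] using mono by (intro sum.cong) auto
  also have "\<dots> = (\<Sum>a\<in>?K. \<Sum>i\<in>?K. c a * (\<Prod>l\<in>UNIV. t l (i l) ^ a l) * ?B i)"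
    by (simp add: sum_distrib_left mult.assoc)
  also have "\<dots> = (\<Sum>i\<in>?K. \<Sum>a\<in>?K. c a * (\<Prod>l\<in>UNIV. t l (i l) ^ a l) * ?B i)"
    by (rule sum.swap)
  also have "\<dots> = (\<Sum>i\<in>?K. f (\<chi> l. t l (i l)) * ?B i)"
    by (simp add: c sum_distrib_right)
  finally show ?thesis .
qed

text \<open>Distinct nodes are at least \<open>h\<close> apart, so each of the \<open>n\<close>
  factors is at most \<open>Suc n\<close>. The bound depends neither on the mesh \<open>h\<close>
  nor on the shift \<open>u\<close>.\<close>

lemma abs_lagrange_basis_le:
  assumes "0 < h" "i \<le> n" and t: "\<And>j. t j = u + real j * h"
    and x: "\<And>j. j \<le> n \<Longrightarrow> \<bar>x - t j\<bar> \<le> real (Suc n) * h"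
  shows "\<bar>lagrange_basis t n i x\<bar> \<le> real (Suc n) ^ n"
proof -
  have "\<bar>lagrange_basis t n i x\<bar> = (\<Prod>j\<in>{..n} - {i}. \<bar>(x - t j) / (t i - t j)\<bar>)"
    by (simp add: lagrange_basis_def abs_prod)
  also have "\<dots> \<le> (\<Prod>j\<in>{..n} - {i}. real (Suc n))"
  proof (intro prod_mono conjI)
    fix j assume j: "j \<in> {..n} - {i}"
    have "t i - t j = (real i - real j) * h" by (simp add: t algebra_simps)
    moreover have "1 \<le> \<bar>real i - real j\<bar>" using j by auto
    ultimately have h: "h \<le> \<bar>t i - t j\<bar>" using \<open>0 < h\<close> by (simp add: abs_mult)
    have "\<bar>x - t j\<bar> \<le> real (Suc n) * h" using x j by auto
    also have "\<dots> \<le> real (Suc n) * \<bar>t i - t j\<bar>" using h by (intro mult_left_mono) auto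
    finally show "\<bar>(x - t j) / (t i - t j)\<bar> \<le> real (Suc n)"
      using h \<open>0 < h\<close> by (simp add: abs_divide divide_le_eq del: of_nat_Suc)
  qed auto
  also have "\<dots> = real (Suc n) ^ n" using \<open>i \<le> n\<close> by simp
  finally show ?thesis .
qed

text \<open>Valid for every \<open>p > 0\<close>, where convexity would require
  \<open>p >= 1\<close>: the sum is at most the number of terms times the largest one, and the power
  of the largest one is a term on the right.\<close>

lemma sum_powr_le:
  fixes y :: "'i \<Rightarrow> real"
  assumes "finite S" "\<And>i. i \<in> S \<Longrightarrow> 0 \<le> y i" "0 < p"
  shows "(\<Sum>i\<in>S. y i) powr p \<le> real (card S) powr p * (\<Sum>i\<in>S. y i powr p)"
proof (cases "S = {}")
  case False
  define M where "M = Max (y ` S)"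
  have "M \<in> y ` S" unfolding M_def using False assms(1) by (intro Max_in) auto
  then obtain k where k: "k \<in> S" "y k = M" by auto
  have "y i \<le> M" if "i \<in> S" for i using that assms(1) by (auto simp: M_def)
  then have "(\<Sum>i\<in>S. y i) \<le> real (card S) * M" using sum_bounded_above by blast
  then have "(\<Sum>i\<in>S. y i) powr p \<le> (real (card S) * M) powr p"
    using assms by (intro powr_mono2 sum_nonneg) auto
  also have "\<dots> = real (card S) powr p * M powr p"
    using k assms by (simp add: powr_mult)
  also have "M powr p \<le> (\<Sum>i\<in>S. y i powr p)"
    using member_le_sum[OF k(1), of "\<lambda>i. y i powr p"] assms(1) k by auto
  finally show ?thesis by (simp add: mult_left_mono)
qed simp

lemma emeasure_lborel_box_cart:
  fixes a b :: "real ^ 'n::finite"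
  assumes "\<And>l. a $ l \<le> b $ l"
  shows "emeasure lborel (box a b) = ennreal (\<Prod>l\<in>UNIV. b $ l - a $ l)"
proof -
  have "emeasure lborel (box a b) = emeasure lborel (cbox a b)"
    by (simp add: emeasure_lborel_box_eq emeasure_lborel_cbox_eq)
  also have "\<dots> = ennreal (measure lborel (cbox a b))"
    by (intro emeasure_eq_ennreal_measure) (use emeasure_lborel_cbox_finite[of a b] in auto)
  also have "measure lborel (cbox a b) = (\<Prod>l\<in>UNIV. b $ l - a $ l)"
    using assms by (intro content_cbox_cart) (auto simp: interval_ne_empty_cart)
  finally show ?thesis .
qed

text \<open>Lagrange interpolation at a uniform grid, shifted by \<open>u\<close>, bounds \<open>f x\<close> by the values of \<open>f\<close> at
  the grid points; averaging over the shift \<open>u\<close> turns these values into integrals.\<close>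

lemma box_polynomial_sup_le:
  fixes r :: "'n::finite \<Rightarrow> nat"
  assumes "0 < p"
  shows "\<exists>C>0. \<forall>f\<in>box_polynomials r. \<forall>a b. \<forall>x\<in>cbox a b. (\<forall>l. a $ l < b $ l) \<longrightarrow>
     ennreal (\<bar>f x\<bar> powr p * (\<Prod>l\<in>UNIV. b $ l - a $ l))
       \<le> ennreal C * (\<integral>\<^sup>+y. ennreal (\<bar>f y\<bar> powr p) * indicator (box a b) y \<partial>lborel)"
proof -
  \<comment> \<open>\<open>K\<close> indexes the grid, \<open>B\<close> bounds a tensor product of
    basis functions, \<open>N\<close> counts the grid points, and \<open>D\<close> is the ratio of
    the volumes of \<open>box a b\<close> and of the shift range \<open>box 0 h\<close>.\<close>
  define K where "K = (PiE UNIV (\<lambda>l. {..r l}) :: ('n \<Rightarrow> nat) set)"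
  define B where "B = (\<Prod>l\<in>UNIV. real (Suc (r l)) ^ r l)"
  define D where "D = (\<Prod>l\<in>UNIV. real (Suc (r l)))"
  define N where "N = real (card K)"
  have fin: "finite K" unfolding K_def by (intro finite_PiE) auto
  have "K \<noteq> {}" unfolding K_def by (auto simp: PiE_eq_empty_iff)
  with fin have N: "0 < N" unfolding N_def by (simp add: card_gt_0_iff)
  have B: "0 < B" and D: "0 < D" unfolding B_def D_def by (auto intro!: prod_pos)
  define E where "E = B powr p * N powr p"
  have E: "0 < E" using B N by (simp add: E_def)
  show ?thesis
  proof (intro exI[of _ "D * (E * N)"] conjI ballI allI impI)
    show "0 < D * (E * N)" using B N D E by simp
    fix f :: "real ^ 'n \<Rightarrow> real" and a b x :: "real ^ 'n"
    assume f: "f \<in> box_polynomials r" and x: "x \<in> cbox a b" and ab: "\<forall>l. a $ l < b $ l"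
    have [measurable]: "f \<in> borel_measurable borel" using f by (rule borel_measurable_box_polynomial)
    \<comment> \<open>With mesh \<open>(b - a) / (r + 1)\<close> the \<open>r + 1\<close> nodes in a
      direction leave room for a shift by less than one mesh width: shifted nodes remain inside
      \<open>box a b\<close>.\<close>
    define h where "h = (\<chi> l. (b $ l - a $ l) / real (Suc (r l)))"
    define v where "v i = (\<chi> l. a $ l + real (i l) * h $ l)" for i
    have h: "0 < h $ l" "real (Suc (r l)) * h $ l = b $ l - a $ l" for l
      using ab by (auto simp: h_def)
    have inbox: "v i + u \<in> box a b" if "i \<in> K" "u \<in> box 0 h" for i u
      unfolding mem_box_cart
    proof (intro allI conjI)
      fix l
      have u: "0 < u $ l" "u $ l < h $ l" using that(2) by (auto simp: mem_box_cart)
      have "0 < real (i l) * h $ l + u $ l" using h(1)[of l] u by (intro add_nonneg_pos mult_nonneg_nonneg) auto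
      then show "a $ l < (v i + u) $ l" by (simp add: v_def)
      have "i l \<le> r l" using that(1) by (auto simp: K_def)
      then have "real (i l) * h $ l \<le> real (r l) * h $ l" using h(1)[of l] by simp
      moreover have "real (Suc (r l)) * h $ l = real (r l) * h $ l + h $ l" by (simp add: algebra_simps)
      moreover have "(v i + u) $ l = a $ l + real (i l) * h $ l + u $ l" by (simp add: v_def)
      ultimately show "(v i + u) $ l < b $ l" using u h(2)[of l] by linarith
    qed
    have pt: "\<bar>f x\<bar> powr p \<le> E * (\<Sum>i\<in>K. \<bar>f (v i + u)\<bar> powr p)" if u: "u \<in> box 0 h" for u
    proof -
      define t where "t l j = a $ l + u $ l + real j * h $ l" for l j
      have inj: "inj_on (t l) {..r l}" for l using h(1)[of l] by (auto simp: inj_on_def t_def)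
      have vt: "(\<chi> l. t l (i l)) = v i + u" for i by (simp add: vec_eq_iff v_def t_def)
      \<comment> \<open>The point \<open>x\<close> and the nodes all lie in \<open>cbox a b\<close>,
        whose side is exactly \<open>Suc (r l) * h $ l\<close>.\<close>
      have L: "\<bar>lagrange_basis (t l) (r l) (i l) (x $ l)\<bar> \<le> real (Suc (r l)) ^ r l" if "i \<in> K" for i l
      proof (rule abs_lagrange_basis_le)
        show "0 < h $ l" by (rule h)
        show "i l \<le> r l" using that by (auto simp: K_def)
        show "t l j = a $ l + u $ l + real j * h $ l" for j by (simp add: t_def)
        fix j assume "j \<le> r l"
        have u': "0 < u $ l" "u $ l < h $ l" using u by (auto simp: mem_box_cart)
        have "0 \<le> real j * h $ l" "real j * h $ l \<le> real (r l) * h $ l"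
          using h(1)[of l] \<open>j \<le> r l\<close> by simp_all
        moreover have "real (Suc (r l)) * h $ l = real (r l) * h $ l + h $ l" by (simp add: algebra_simps)
        moreover have "a $ l \<le> x $ l" "x $ l \<le> b $ l" using x by (auto simp: mem_box_cart)
        ultimately show "\<bar>x $ l - t l j\<bar> \<le> real (Suc (r l)) * h $ l"
          using h(2)[of l] u' unfolding t_def by linarith
      qed
      have "f x = (\<Sum>i\<in>K. f (v i + u) * (\<Prod>l\<in>UNIV. lagrange_basis (t l) (r l) (i l) (x $ l)))"
        using lagrange_tensor[OF f inj, of x] unfolding vt K_def .
      also have "\<bar>\<dots>\<bar> \<le> (\<Sum>i\<in>K. \<bar>f (v i + u)\<bar> * B)"
      proof (intro order.trans[OF sum_abs] sum_mono)
        fix i assume i: "i \<in> K"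
        have "\<bar>\<Prod>l\<in>UNIV. lagrange_basis (t l) (r l) (i l) (x $ l)\<bar> \<le> B"
          unfolding B_def abs_prod using L[OF i] by (intro prod_mono) auto
        then show "\<bar>f (v i + u) * (\<Prod>l\<in>UNIV. lagrange_basis (t l) (r l) (i l) (x $ l))\<bar> \<le> \<bar>f (v i + u)\<bar> * B"
          by (simp add: abs_mult mult_left_mono)
      qed
      finally have "\<bar>f x\<bar> \<le> B * (\<Sum>i\<in>K. \<bar>f (v i + u)\<bar>)"
        by (simp add: sum_distrib_left mult.commute)
      then have "\<bar>f x\<bar> powr p \<le> (B * (\<Sum>i\<in>K. \<bar>f (v i + u)\<bar>)) powr p"
        using \<open>0 < p\<close> by (intro powr_mono2) auto
      also have "\<dots> = B powr p * (\<Sum>i\<in>K. \<bar>f (v i + u)\<bar>) powr p"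
        using B by (simp add: powr_mult sum_nonneg)
      also have "\<dots> \<le> B powr p * (N powr p * (\<Sum>i\<in>K. \<bar>f (v i + u)\<bar> powr p))"
        unfolding N_def using fin \<open>0 < p\<close> by (intro mult_left_mono sum_powr_le) auto
      finally show ?thesis by (simp add: E_def mult.assoc)
    qed
    let ?I = "\<integral>\<^sup>+y. ennreal (\<bar>f y\<bar> powr p) * indicator (box a b) y \<partial>lborel"
    have shift: "(\<integral>\<^sup>+u. ennreal (\<bar>f (v i + u)\<bar> powr p) * indicator (box 0 h) u \<partial>lborel) \<le> ?I" if "i \<in> K" for i
    proof -
      have "?I = (\<integral>\<^sup>+y. ennreal (\<bar>f y\<bar> powr p) * indicator (box a b) y \<partial>distr lborel borel ((+) (v i)))"
        by (simp add: lborel_distr_plus)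
      also have "\<dots> = (\<integral>\<^sup>+u. ennreal (\<bar>f (v i + u)\<bar> powr p) * indicator (box a b) (v i + u) \<partial>lborel)"
        by (subst nn_integral_distr) auto
      finally show ?thesis
        using inbox[OF that] by (auto intro!: nn_integral_mono split: split_indicator)
    qed
    \<comment> \<open>Averaging over the shift: the left-hand side of \<open>pt\<close> is constant
      in \<open>u\<close>, and each summand on the right integrates to at most the integral over the
      full box.\<close>
    have "ennreal (\<bar>f x\<bar> powr p) * emeasure lborel (box 0 h)
        = (\<integral>\<^sup>+u. ennreal (\<bar>f x\<bar> powr p) * indicator (box 0 h) u \<partial>lborel)"
      by (simp add: nn_integral_cmult_indicator)
    also have "\<dots> \<le> (\<integral>\<^sup>+u. ennreal E * (\<Sum>i\<in>K. ennreal (\<bar>f (v i + u)\<bar> powr p) * indicator (box 0 h) u) \<partial>lborel)"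
    proof (intro nn_integral_mono)
      fix u :: "real ^ 'n"
      show "ennreal (\<bar>f x\<bar> powr p) * indicator (box 0 h) u
          \<le> ennreal E * (\<Sum>i\<in>K. ennreal (\<bar>f (v i + u)\<bar> powr p) * indicator (box 0 h) u)"
      proof (cases "u \<in> box 0 h")
        case True
        then show ?thesis using pt[OF True] E
          by (simp add: ennreal_leI sum_nonneg flip: ennreal_mult)
      qed simp
    qed
    also have "\<dots> = ennreal E * (\<Sum>i\<in>K. \<integral>\<^sup>+u. ennreal (\<bar>f (v i + u)\<bar> powr p) * indicator (box 0 h) u \<partial>lborel)"
      by (subst nn_integral_cmult) (auto simp: nn_integral_sum)
    also have "\<dots> \<le> ennreal E * (\<Sum>i\<in>K. ?I)"
      using shift by (intro mult_left_mono sum_mono) auto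
    also have "\<dots> = ennreal (E * N) * ?I"
      using E N by (simp add: N_def ennreal_mult ennreal_of_nat_eq_real_of_nat mult.assoc)
    finally have *: "ennreal (\<bar>f x\<bar> powr p) * emeasure lborel (box 0 h) \<le> ennreal (E * N) * ?I" .
    have "emeasure lborel (box 0 h) = ennreal (\<Prod>l\<in>UNIV. h $ l)"
      using h(1) by (subst emeasure_lborel_box_cart) (auto intro: less_imp_le)
    also have "(\<Prod>l\<in>UNIV. h $ l) = (\<Prod>l\<in>UNIV. b $ l - a $ l) / D"
      by (simp add: h_def D_def prod_dividef)
    finally have em: "emeasure lborel (box 0 h) = ennreal ((\<Prod>l\<in>UNIV. b $ l - a $ l) / D)" .
    have w: "0 \<le> (\<Prod>l\<in>UNIV. b $ l - a $ l)" using ab by (intro prod_nonneg) (auto intro: less_imp_le)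
    have "ennreal (\<bar>f x\<bar> powr p * (\<Prod>l\<in>UNIV. b $ l - a $ l))
        = ennreal D * (ennreal (\<bar>f x\<bar> powr p) * emeasure lborel (box 0 h))"
      using D w by (simp add: em flip: ennreal_mult)
    also have "\<dots> \<le> ennreal D * (ennreal (E * N) * ?I)"
      using * by (intro mult_left_mono) auto
    also have "\<dots> = ennreal (D * (E * N)) * ?I"
      using D E N by (simp add: ennreal_mult mult.assoc)
    finally show "ennreal (\<bar>f x\<bar> powr p * (\<Prod>l\<in>UNIV. b $ l - a $ l)) \<le> ennreal (D * (E * N)) * ?I" .
  qed
qed

section \<open>Lebesgue norms\<close>

lemma ennreal_powr_inverse_le_iff:
  assumes "0 < p" "0 \<le> c"
  shows "ennreal_powr x (1 / p) \<le> ennreal c \<longleftrightarrow> x \<le> ennreal (c powr p)"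
proof (cases x)
  case (real y)
  have "y powr (1 / p) \<le> c \<longleftrightarrow> y \<le> c powr p"
  proof
    assume "y powr (1 / p) \<le> c"
    then have "(y powr (1 / p)) powr p \<le> c powr p" using assms by (intro powr_mono2) auto
    then show "y \<le> c powr p" using real assms by (simp add: powr_powr)
  next
    assume "y \<le> c powr p"
    then have "y powr (1 / p) \<le> (c powr p) powr (1 / p)" using assms real by (intro powr_mono2) auto
    then show "y powr (1 / p) \<le> c" using assms by (simp add: powr_powr)
  qed
  then show ?thesis using real assms by (simp add: ennreal_powr_def ennreal_le_iff)
next
  case top
  then show ?thesis by (simp add: ennreal_powr_def top_unique)
qed

lemma Lp_norm_le_iff:
  assumes "0 < p" "0 \<le> c"
  shows "Lp_norm M (ennreal p) f \<le> ennreal c \<longleftrightarrow> (\<integral>\<^sup>+x. ennreal (\<bar>f x\<bar> powr p) \<partial>M) \<le> ennreal (c powr p)"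
  using assms by (simp add: Lp_norm_def ennreal_powr_inverse_le_iff)

lemma Lp_norm_infinity_le:
  assumes "f \<in> borel_measurable M" "AE x in M. \<bar>f x\<bar> \<le> c"
  shows "Lp_norm M \<infinity> f \<le> ennreal c"
  unfolding Lp_norm_def using assms by (auto intro!: esssup_I elim!: eventually_mono intro: ennreal_leI)

lemma AE_le_Lp_norm_infinity:
  assumes "Lp_norm M \<infinity> f \<le> ennreal c" "0 \<le> c"
  shows "AE x in M. \<bar>f x\<bar> \<le> c"
  using esssup_AE[of "\<lambda>x. ennreal \<bar>f x\<bar>" M]
proof eventually_elim
  case (elim x)
  also have "esssup M (\<lambda>x. ennreal \<bar>f x\<bar>) \<le> ennreal c" using assms(1) by (simp add: Lp_norm_def)
  finally show ?case using assms(2) by (simp add: ennreal_le_iff)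
qed

lemma powr_add_le:
  fixes a b p :: real
  assumes "0 \<le> a" "0 \<le> b" "0 < p"
  shows "(a + b) powr p \<le> 2 powr p * (a powr p + b powr p)"
proof -
  have "(a + b) powr p \<le> (2 * max a b) powr p" using assms by (intro powr_mono2) auto
  also have "\<dots> = 2 powr p * max a b powr p" using assms by (simp add: powr_mult)
  also have "max a b powr p \<le> a powr p + b powr p" by (simp add: max_def)
  finally show ?thesis by (simp add: mult_left_mono)
qed

text \<open>A quasi-triangle inequality for integrals of \<open>p\<close>-th powers, with a constant
  that is valid also for \<open>p < 1\<close>.\<close>

lemma nn_integral_powr_diff_le:
  assumes [measurable]: "f \<in> borel_measurable M" "g \<in> borel_measurable M" and "0 < p" "0 \<le> A" "0 \<le> B"
    and "(\<integral>\<^sup>+x. ennreal (\<bar>f x\<bar> powr p) \<partial>M) \<le> ennreal A" "(\<integral>\<^sup>+x. ennreal (\<bar>g x\<bar> powr p) \<partial>M) \<le> ennreal B"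
  shows "(\<integral>\<^sup>+x. ennreal (\<bar>f x - g x\<bar> powr p) \<partial>M) \<le> ennreal (2 powr p * (A + B))"
proof -
  have "(\<integral>\<^sup>+x. ennreal (\<bar>f x - g x\<bar> powr p) \<partial>M)
      \<le> (\<integral>\<^sup>+x. ennreal (2 powr p) * (ennreal (\<bar>f x\<bar> powr p) + ennreal (\<bar>g x\<bar> powr p)) \<partial>M)"
  proof (rule nn_integral_mono)
    fix x
    have "\<bar>f x - g x\<bar> powr p \<le> (\<bar>f x\<bar> + \<bar>g x\<bar>) powr p" using \<open>0 < p\<close> by (intro powr_mono2) auto
    also have "\<dots> \<le> 2 powr p * (\<bar>f x\<bar> powr p + \<bar>g x\<bar> powr p)" using \<open>0 < p\<close> by (intro powr_add_le) auto
    finally show "ennreal (\<bar>f x - g x\<bar> powr p) \<le> ennreal (2 powr p) * (ennreal (\<bar>f x\<bar> powr p) + ennreal (\<bar>g x\<bar> powr p))"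
      by (simp add: ennreal_leI flip: ennreal_mult ennreal_plus)
  qed
  also have "\<dots> = ennreal (2 powr p) * ((\<integral>\<^sup>+x. ennreal (\<bar>f x\<bar> powr p) \<partial>M) + (\<integral>\<^sup>+x. ennreal (\<bar>g x\<bar> powr p) \<partial>M))"
    by (simp add: nn_integral_cmult nn_integral_add)
  also have "\<dots> \<le> ennreal (2 powr p) * (ennreal A + ennreal B)"
    using assms by (intro mult_left_mono add_mono) auto
  finally show ?thesis using assms by (simp add: ennreal_mult)
qed

text \<open>Extends convexity from the open half-line to 0. If one of the points is 0, the
  inequality reduces to \<open>s powr q <= s\<close> for \<open>0 < s < 1\<close>.\<close>

lemma convex_on_powr_nonneg:
  assumes "1 \<le> (q::real)"
  shows "convex_on {0..} (\<lambda>x. x powr q)"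
proof (rule convex_onI)
  fix t x y :: real assume t: "0 < t" "t < 1" and xy: "x \<in> {0..}" "y \<in> {0..}"
  have small: "s powr q \<le> s" if "0 < s" "s < 1" for s :: real
    using powr_mono'[of 1 q s] that assms by simp
  show "((1 - t) *\<^sub>R x + t *\<^sub>R y) powr q \<le> (1 - t) * x powr q + t * y powr q"
  proof (cases "x = 0 \<or> y = 0")
    case True
    then show ?thesis
      using small[of t] small[of "1 - t"] t xy
      by (auto simp: powr_mult intro!: mult_right_mono)
  next
    case False
    then show ?thesis
      using convex_onD[OF powr_convex[OF assms], of t x y] t xy by auto
  qed
qed simp

text \<open>Convexity of the power with weights \<open>b i / S\<close>, applied to the normalized
  functions \<open>g i / b i\<close>, followed by integration.\<close>

lemma nn_integral_Minkowski:
  assumes "1 \<le> q" "finite F" and [measurable]: "\<And>i. i \<in> F \<Longrightarrow> g i \<in> borel_measurable M"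
    and g: "\<And>i x. i \<in> F \<Longrightarrow> 0 \<le> g i x" and b: "\<And>i. i \<in> F \<Longrightarrow> 0 < b i"
    and le: "\<And>i. i \<in> F \<Longrightarrow> (\<integral>\<^sup>+x. ennreal (g i x powr q) \<partial>M) \<le> ennreal (b i powr q)"
  shows "(\<integral>\<^sup>+x. ennreal ((\<Sum>i\<in>F. g i x) powr q) \<partial>M) \<le> ennreal ((\<Sum>i\<in>F. b i) powr q)"
proof (cases "F = {}")
  case False
  define S where "S = (\<Sum>i\<in>F. b i)"
  have S: "0 < S" unfolding S_def using b False \<open>finite F\<close> by (intro sum_pos) auto
  \<comment> \<open>The coefficient of \<open>g i x powr q\<close> once the normalizations by
    \<open>S\<close> and \<open>b i\<close> are taken out of the power.\<close>
  define w where "w i = S powr q * (b i / S) / b i powr q" for i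
  have w: "0 \<le> w i" if "i \<in> F" for i using S b[OF that] by (simp add: w_def)
  have pt: "(\<Sum>i\<in>F. g i x) powr q \<le> (\<Sum>i\<in>F. w i * g i x powr q)" for x
  proof -
    have "(\<Sum>i\<in>F. g i x) = S * (\<Sum>i\<in>F. (b i / S) *\<^sub>R (g i x / b i))"
      using S b by (simp add: sum_distrib_left) (intro sum.cong, auto simp: less_imp_neq[symmetric] dest: b)
    then have "(\<Sum>i\<in>F. g i x) powr q = S powr q * (\<Sum>i\<in>F. (b i / S) *\<^sub>R (g i x / b i)) powr q"
      using S b g by (simp add: powr_mult sum_nonneg less_imp_le)
    also have "(\<Sum>i\<in>F. (b i / S) *\<^sub>R (g i x / b i)) powr q \<le> (\<Sum>i\<in>F. (b i / S) * (g i x / b i) powr q)"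
    proof (rule convex_on_sum[OF \<open>finite F\<close> False convex_on_powr_nonneg[OF \<open>1 \<le> q\<close>]])
      show "(\<Sum>i\<in>F. b i / S) = 1" using S by (simp add: S_def flip: sum_divide_distrib)
    qed (use S b g in \<open>auto simp: less_imp_le\<close>)
    also have "S powr q * \<dots> = (\<Sum>i\<in>F. w i * g i x powr q)"
      unfolding sum_distrib_left using b g
      by (intro sum.cong) (auto simp: w_def powr_divide less_imp_le)
    finally show ?thesis by (simp add: mult_left_mono)
  qed
  have "(\<integral>\<^sup>+x. ennreal ((\<Sum>i\<in>F. g i x) powr q) \<partial>M) \<le> (\<integral>\<^sup>+x. (\<Sum>i\<in>F. ennreal (w i) * ennreal (g i x powr q)) \<partial>M)"
  proof (rule nn_integral_mono)
    fix x
    have "ennreal ((\<Sum>i\<in>F. g i x) powr q) \<le> ennreal (\<Sum>i\<in>F. w i * g i x powr q)"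
      using pt by (rule ennreal_leI)
    also have "\<dots> = (\<Sum>i\<in>F. ennreal (w i * g i x powr q))"
      using w by (intro sum_ennreal[symmetric]) auto
    also have "\<dots> = (\<Sum>i\<in>F. ennreal (w i) * ennreal (g i x powr q))"
      using w by (intro sum.cong ennreal_mult) auto
    finally show "ennreal ((\<Sum>i\<in>F. g i x) powr q) \<le> (\<Sum>i\<in>F. ennreal (w i) * ennreal (g i x powr q))" .
  qed
  also have "\<dots> = (\<Sum>i\<in>F. ennreal (w i) * (\<integral>\<^sup>+x. ennreal (g i x powr q) \<partial>M))"
    by (simp add: nn_integral_sum nn_integral_cmult)
  also have "\<dots> \<le> (\<Sum>i\<in>F. ennreal (w i) * ennreal (b i powr q))"
    using le by (intro sum_mono mult_left_mono) auto
  also have "\<dots> = (\<Sum>i\<in>F. ennreal (S powr q * (b i / S)))"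
  proof (intro sum.cong refl)
    fix i assume "i \<in> F"
    then show "ennreal (w i) * ennreal (b i powr q) = ennreal (S powr q * (b i / S))"
      using w[of i] b[of i] by (simp add: w_def flip: ennreal_mult)
  qed
  also have "\<dots> = ennreal (\<Sum>i\<in>F. S powr q * (b i / S))"
    using S b by (intro sum_ennreal) (auto simp: less_imp_le)
  also have "(\<Sum>i\<in>F. S powr q * (b i / S)) = S powr q"
    using S by (simp add: S_def flip: sum_distrib_left sum_divide_distrib)
  finally show ?thesis by (simp add: S_def)
qed simp

text \<open>Turns a pointwise bound on partial telescoping sums into a norm bound for the limit. For
  finite \<open>q\<close> this is Fatou followed by Minkowski; for \<open>q = \<infinity>\<close>
  the bounds hold simultaneously outside one null set and pass to the limit pointwise.\<close>

lemma Lp_norm_limit_le: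
  fixes f :: "'a \<Rightarrow> real" and N :: "nat \<Rightarrow> nat"
  assumes "1 \<le> q" and [measurable]: "f \<in> borel_measurable M" "\<And>n. u n \<in> borel_measurable M"
      "\<And>j. g j \<in> borel_measurable M"
    and lim: "AE x in M. (\<lambda>n. u n x) \<longlonglongrightarrow> f x"
    and u: "\<And>n x. x \<in> space M \<Longrightarrow> \<bar>u n x\<bar> \<le> (\<Sum>j<N n. g j x)"
    and g: "\<And>j x. 0 \<le> g j x" and b: "\<And>j. 0 < b j" "\<And>n. (\<Sum>j<n. b j) \<le> B"
    and le: "\<And>j. Lp_norm M q (g j) \<le> ennreal (b j)"
  shows "Lp_norm M q f \<le> ennreal B"
proof (cases q)
  case top
  have "AE x in M. \<bar>g j x\<bar> \<le> b j" for j
    using le[of j] b(1)[of j] top by (intro AE_le_Lp_norm_infinity) auto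
  then have "AE x in M. \<forall>j. \<bar>g j x\<bar> \<le> b j" by (simp add: AE_all_countable)
  then have "AE x in M. \<bar>f x\<bar> \<le> B"
    using lim AE_space
  proof eventually_elim
    case (elim x)
    have "\<bar>u n x\<bar> \<le> B" for n
    proof -
      have "(\<Sum>j<N n. g j x) \<le> (\<Sum>j<N n. b j)" using elim(1) by (intro sum_mono) (auto simp: abs_le_iff)
      with u[OF elim(3), of n] b(2)[of "N n"] show ?thesis by linarith
    qed
    moreover have "(\<lambda>n. \<bar>u n x\<bar>) \<longlonglongrightarrow> \<bar>f x\<bar>" using elim(2) by (rule tendsto_rabs)
    ultimately show ?case by (intro LIMSEQ_le_const2) auto
  qed
  then show ?thesis using top Lp_norm_infinity_le[of f M B] by simp
next
  case (real q')
  then have q': "1 \<le> q'" "0 < q'" using \<open>1 \<le> q\<close> by (auto simp: ennreal_1[symmetric] simp del: ennreal_1)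
  have B: "0 \<le> B" using b(2)[of 0] by simp
  have "(\<integral>\<^sup>+x. ennreal (\<bar>f x\<bar> powr q') \<partial>M) = (\<integral>\<^sup>+x. liminf (\<lambda>n. ennreal (\<bar>u n x\<bar> powr q')) \<partial>M)"
  proof (rule nn_integral_cong_AE)
    show "AE x in M. ennreal (\<bar>f x\<bar> powr q') = liminf (\<lambda>n. ennreal (\<bar>u n x\<bar> powr q'))"
      using lim
    proof eventually_elim
      case (elim x)
      have "(\<lambda>n. ennreal (\<bar>u n x\<bar> powr q')) \<longlonglongrightarrow> ennreal (\<bar>f x\<bar> powr q')"
        using elim q' by (intro tendsto_intros tendsto_powr2) auto
      then show ?case by (intro lim_imp_Liminf[symmetric]) auto
    qed
  qed
  also have "\<dots> \<le> liminf (\<lambda>n. \<integral>\<^sup>+x. ennreal (\<bar>u n x\<bar> powr q') \<partial>M)"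
    by (rule nn_integral_liminf) simp
  also have "\<dots> \<le> ennreal (B powr q')"
  proof (rule Liminf_le)
    show "\<forall>\<^sub>F n in sequentially. (\<integral>\<^sup>+x. ennreal (\<bar>u n x\<bar> powr q') \<partial>M) \<le> ennreal (B powr q')"
    proof (intro always_eventually allI)
      fix n
      have "(\<integral>\<^sup>+x. ennreal (\<bar>u n x\<bar> powr q') \<partial>M) \<le> (\<integral>\<^sup>+x. ennreal ((\<Sum>j<N n. g j x) powr q') \<partial>M)"
        using u q' by (intro nn_integral_mono ennreal_leI powr_mono2) auto
      also have "\<dots> \<le> ennreal ((\<Sum>j<N n. b j) powr q')"
      proof (rule nn_integral_Minkowski)
        fix j
        show "(\<integral>\<^sup>+x. ennreal (g j x powr q') \<partial>M) \<le> ennreal (b j powr q')"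
          using le[of j] g[of j] b(1)[of j] q' by (simp add: real Lp_norm_le_iff less_imp_le)
      qed (use q' g b in auto)
      also have "\<dots> \<le> ennreal (B powr q')"
        using b q' by (intro ennreal_leI powr_mono2 sum_nonneg) (auto intro: less_imp_le)
      finally show "(\<integral>\<^sup>+x. ennreal (\<bar>u n x\<bar> powr q') \<partial>M) \<le> ennreal (B powr q')" .
    qed
  qed simp
  finally show ?thesis using q' B by (simp add: real Lp_norm_le_iff)
qed

text \<open>By monotone convergence the series of \<open>p\<close>-th powers has finite integral,
  hence converges almost everywhere, and so its terms tend to 0 there.\<close>

lemma AE_tendsto_0_if_summable_powr:
  fixes h :: "nat \<Rightarrow> 'a \<Rightarrow> real"
  assumes [measurable]: "\<And>j. h j \<in> borel_measurable M" and "0 < p"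
    and fin: "(\<Sum>j. \<integral>\<^sup>+x. ennreal (\<bar>h j x\<bar> powr p) \<partial>M) < \<infinity>"
  shows "AE x in M. (\<lambda>j. h j x) \<longlonglongrightarrow> 0"
proof -
  have "(\<integral>\<^sup>+x. (\<Sum>j. ennreal (\<bar>h j x\<bar> powr p)) \<partial>M) < \<infinity>"
    using fin by (subst nn_integral_suminf) auto
  then have "AE x in M. (\<Sum>j. ennreal (\<bar>h j x\<bar> powr p)) \<noteq> \<infinity>"
    by (intro nn_integral_PInf_AE) auto
  then show ?thesis
  proof eventually_elim
    case (elim x)
    then have "summable (\<lambda>j. \<bar>h j x\<bar> powr p)"
      by (intro summable_suminf_not_top) auto
    then have "(\<lambda>j. \<bar>h j x\<bar> powr p) \<longlonglongrightarrow> 0" by (rule summable_LIMSEQ_zero)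
    then have "(\<lambda>j. (\<bar>h j x\<bar> powr p) powr (1 / p)) \<longlonglongrightarrow> 0 powr (1 / p)"
      using \<open>0 < p\<close> by (intro tendsto_powr2) auto
    then show ?case using \<open>0 < p\<close> by (simp add: powr_powr tendsto_rabs_zero_iff)
  qed
qed

text \<open>Splitting according to \<open>\<bar>f x\<bar> \<le> A\<close> bounds the
  \<open>q'\<close>-th power by \<open>A powr q' + A powr (q' - p) * \<bar>f x\<bar> powr p\<close>.
  This replaces Hoelder at the cost of a factor 2, which can be moved inside the power since
  \<open>q' >= 1\<close>.\<close>

lemma Lp_norm_le_finite_measure:
  assumes "emeasure M (space M) \<le> 1" "f \<in> borel_measurable M" "1 \<le> q" "q \<le> ennreal p" "0 < A"
    and le: "Lp_norm M (ennreal p) f \<le> ennreal A"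
  shows "Lp_norm M q f \<le> ennreal (2 * A)"
proof -
  obtain q' where q: "q = ennreal q'" "0 \<le> q'" using \<open>q \<le> ennreal p\<close> by (cases q) (auto simp: top_unique)
  then have q': "1 \<le> q'" "q' \<le> p"
    using assms(3,4) by (auto simp: ennreal_1[symmetric] ennreal_le_iff2 simp del: ennreal_1)
  note [measurable] = assms(2)
  have I: "(\<integral>\<^sup>+x. ennreal (\<bar>f x\<bar> powr p) \<partial>M) \<le> ennreal (A powr p)"
    using le q' \<open>0 < A\<close> by (simp add: Lp_norm_le_iff)
  have "(\<integral>\<^sup>+x. ennreal (\<bar>f x\<bar> powr q') \<partial>M)
      \<le> (\<integral>\<^sup>+x. ennreal (A powr q') + ennreal (A powr (q' - p)) * ennreal (\<bar>f x\<bar> powr p) \<partial>M)"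
  proof (rule nn_integral_mono)
    fix x
    have "\<bar>f x\<bar> powr q' \<le> A powr q' + A powr (q' - p) * \<bar>f x\<bar> powr p"
    proof (cases "\<bar>f x\<bar> \<le> A")
      case True
      then have "\<bar>f x\<bar> powr q' \<le> A powr q'" using q' by (intro powr_mono2) auto
      then show ?thesis by (simp add: add_increasing2)
    next
      case False
      then have "\<bar>f x\<bar> powr (q' - p) \<le> A powr (q' - p)" using \<open>0 < A\<close> q' by (intro powr_mono2') auto
      moreover have "\<bar>f x\<bar> powr q' = \<bar>f x\<bar> powr (q' - p) * \<bar>f x\<bar> powr p"
        using False \<open>0 < A\<close> by (simp flip: powr_add)
      ultimately have "\<bar>f x\<bar> powr q' \<le> A powr (q' - p) * \<bar>f x\<bar> powr p" by (simp add: mult_right_mono)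
      then show ?thesis by (simp add: add_increasing)
    qed
    then show "ennreal (\<bar>f x\<bar> powr q') \<le> ennreal (A powr q') + ennreal (A powr (q' - p)) * ennreal (\<bar>f x\<bar> powr p)"
      by (simp add: ennreal_leI flip: ennreal_mult ennreal_plus)
  qed
  also have "\<dots> = ennreal (A powr q') * emeasure M (space M)
      + ennreal (A powr (q' - p)) * (\<integral>\<^sup>+x. ennreal (\<bar>f x\<bar> powr p) \<partial>M)"
    by (simp add: nn_integral_add nn_integral_cmult)
  also have "\<dots> \<le> ennreal (A powr q') * 1 + ennreal (A powr (q' - p)) * ennreal (A powr p)"
    using assms(1) I by (intro add_mono mult_left_mono) auto
  also have "\<dots> = ennreal (2 * A powr q')"
    using \<open>0 < A\<close> by (simp flip: ennreal_mult ennreal_plus powr_add)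
  also have "\<dots> \<le> ennreal ((2 * A) powr q')"
    using \<open>0 < A\<close> q' powr_mono[of 1 q' 2] by (intro ennreal_leI) (simp add: powr_mult)
  finally show ?thesis using q q' \<open>0 < A\<close> by (simp add: Lp_norm_le_iff)
qed

text \<open>The excess power \<open>q' - p\<close> is estimated by the supremum and the remaining
  \<open>p\<close>-th power by the integral. For \<open>q = \<infinity>\<close> the term
  \<open>enn2real (1 / q)\<close> is 0, and the same formula reads
  \<open>S powr (1 / p)\<close>.\<close>

lemma Lp_norm_interpolation:
  assumes [measurable]: "g \<in> borel_measurable M" and "0 < p" "1 \<le> q" "ennreal p \<le> q" "0 < S" "0 < A"
    and sup: "\<And>x. x \<in> space M \<Longrightarrow> \<bar>g x\<bar> powr p \<le> S"
    and int: "(\<integral>\<^sup>+x. ennreal (\<bar>g x\<bar> powr p) \<partial>M) \<le> ennreal A"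
  shows "Lp_norm M q g \<le> ennreal (S powr (1 / p - enn2real (1 / q)) * A powr enn2real (1 / q))"
proof (cases q)
  case top
  have "\<bar>g x\<bar> \<le> S powr (1 / p)" if "x \<in> space M" for x
  proof -
    have "(\<bar>g x\<bar> powr p) powr (1 / p) \<le> S powr (1 / p)"
      using sup[OF that] \<open>0 < p\<close> by (intro powr_mono2) auto
    then show ?thesis using \<open>0 < p\<close> by (simp add: powr_powr)
  qed
  then show ?thesis using top \<open>0 < A\<close> Lp_norm_infinity_le[of g M "S powr (1 / p)"] by simp
next
  case (real q')
  then have q': "1 \<le> q'" "p \<le> q'"
    using assms(2,3,4) by (auto simp: ennreal_1[symmetric] ennreal_le_iff simp del: ennreal_1)
  have e: "enn2real (1 / q) = 1 / q'"
    using q' by (simp add: real divide_ennreal_def inverse_ennreal enn2real_mult inverse_eq_divide)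
  let ?c = "S powr (1 / p - 1 / q') * A powr (1 / q')"
  have "(\<integral>\<^sup>+x. ennreal (\<bar>g x\<bar> powr q') \<partial>M) \<le> (\<integral>\<^sup>+x. ennreal (S powr (q' / p - 1)) * ennreal (\<bar>g x\<bar> powr p) \<partial>M)"
  proof (rule nn_integral_mono)
    fix x assume x: "x \<in> space M"
    have "\<bar>g x\<bar> powr q' = (\<bar>g x\<bar> powr p) powr (q' / p - 1) * \<bar>g x\<bar> powr p"
      using \<open>0 < p\<close> by (simp add: powr_powr field_simps flip: powr_add)
    also have "\<dots> \<le> S powr (q' / p - 1) * \<bar>g x\<bar> powr p"
      using sup[OF x] q' \<open>0 < p\<close> by (intro mult_right_mono powr_mono2) (auto simp: field_simps)
    finally show "ennreal (\<bar>g x\<bar> powr q') \<le> ennreal (S powr (q' / p - 1)) * ennreal (\<bar>g x\<bar> powr p)"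
      by (simp add: ennreal_leI flip: ennreal_mult)
  qed
  also have "\<dots> = ennreal (S powr (q' / p - 1)) * (\<integral>\<^sup>+x. ennreal (\<bar>g x\<bar> powr p) \<partial>M)"
    by (simp add: nn_integral_cmult)
  also have "\<dots> \<le> ennreal (S powr (q' / p - 1)) * ennreal A"
    using int by (intro mult_left_mono) auto
  also have "\<dots> = ennreal (?c powr q')"
    using q' \<open>0 < A\<close> \<open>0 < S\<close> \<open>0 < p\<close>
    by (simp add: powr_mult powr_powr left_diff_distrib flip: ennreal_mult)
  finally show ?thesis using q' unfolding e unfolding real by (simp add: Lp_norm_le_iff)
qed

section \<open>Partitions from trees of cells\<close>

text \<open>\<open>\<Lambda> j\<close> collects the cells of level \<open>j\<close> that must not lie strictly inside a leaf; a cell is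
  refined as long as it properly contains such a cell, which yields the leaf level \<open>lf x\<close> at \<open>x\<close>.\<close>

lemma tree_partition:
  fixes cell :: "nat \<Rightarrow> 'a \<Rightarrow> 'a set"
  assumes self: "\<And>i x. x \<in> X \<Longrightarrow> x \<in> cell i x" and sub: "\<And>i x. cell i x \<subseteq> X"
    and eq: "\<And>i x y. y \<in> cell i x \<Longrightarrow> cell i y = cell i x"
    and mono: "\<And>i x. cell (Suc i) x \<subseteq> cell i x"
    and fin: "\<And>i. finite (cell i ` X)"
    and child: "\<And>i x. card (cell (Suc i) ` cell i x) \<le> c"
    and \<Lambda>: "\<And>j. \<Lambda> j \<subseteq> cell j ` X"
    and "i0 \<le> J"
  obtains lf where
    "partition_on X ((\<lambda>x. cell (lf x) x) ` X)" "finite ((\<lambda>x. cell (lf x) x) ` X)"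
    "card ((\<lambda>x. cell (lf x) x) ` X) \<le> card (cell i0 ` X) + (\<Sum>j\<in>{i0<..J}. (j - i0) * (card (\<Lambda> j) * c))"
    "\<And>x. x \<in> X \<Longrightarrow> i0 \<le> lf x \<and> lf x \<le> J"
    "\<And>x y. x \<in> X \<Longrightarrow> y \<in> cell (lf x) x \<Longrightarrow> lf y = lf x"
    "\<And>x j. x \<in> X \<Longrightarrow> lf x < j \<Longrightarrow> j \<le> J \<Longrightarrow> cell j x \<notin> \<Lambda> j"
proof -
  have mono': "cell j x \<subseteq> cell i x" if "i \<le> j" for i j x
    using lift_Suc_antimono_le[of "\<lambda>i. cell i x", OF mono that] by auto
  \<comment> \<open>The cell of level \<open>i\<close> is good if no cell of
    \<open>\<Lambda>\<close>, of a finer level up to \<open>J\<close>, lies in it. The leaf level is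
    the first good level from \<open>i0\<close> on; level \<open>J\<close> is always good.\<close>
  define good where "good i x \<longleftrightarrow> (\<forall>y\<in>cell i x. \<forall>j. i < j \<and> j \<le> J \<longrightarrow> cell j y \<notin> \<Lambda> j)" for i x
  define lf where "lf x = (LEAST i. i0 \<le> i \<and> good i x)" for x
  define m where "m = (\<lambda>x. cell (lf x) x) ` X"
  have good_J: "i0 \<le> J \<and> good J x" for x using \<open>i0 \<le> J\<close> by (auto simp: good_def)
  have lf: "i0 \<le> lf x" "good (lf x) x" for x
    using LeastI[of "\<lambda>i. i0 \<le> i \<and> good i x", OF good_J] by (simp_all add: lf_def)
  have lf_le: "lf x \<le> J" for x
    unfolding lf_def using good_J by (rule Least_le)
  have not_good: "\<not> good i x" if "i0 \<le> i" "i < lf x" for i x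
    using that not_less_Least[of i "\<lambda>i. i0 \<le> i \<and> good i x"] by (auto simp: lf_def)
  have good_eq: "good i y \<longleftrightarrow> good i x" if "y \<in> cell i x" for i x y
    using eq[OF that] by (simp add: good_def)
  \<comment> \<open>Goodness depends only on the cell, and \<open>y\<close> shares with
    \<open>x\<close> all cells of levels up to \<open>lf x\<close>, so the search for a good level
    stops at the same place.\<close>
  have lf_eq: "lf y = lf x" if "y \<in> cell (lf x) x" for x y
    unfolding lf_def[of y]
  proof (rule Least_equality)
    show "i0 \<le> lf x \<and> good (lf x) y" using lf[of x] good_eq[OF that] by simp
    fix i assume i: "i0 \<le> i \<and> good i y"
    show "lf x \<le> i"
    proof (rule ccontr)
      assume "\<not> lf x \<le> i"
      then have "y \<in> cell i x" using that mono'[of i "lf x" x] by auto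
      with i good_eq not_good[of i x] \<open>\<not> lf x \<le> i\<close> show False by auto
    qed
  qed
  have part: "partition_on X m"
  proof (intro partition_onI)
    show "\<Union> m = X" "{} \<notin> m" using self sub by (fastforce simp: m_def)+
    fix p q assume p: "p \<in> m" and q: "q \<in> m" and neq: "p \<noteq> q"
    obtain x where x: "p = cell (lf x) x" using p by (auto simp: m_def)
    obtain y where y: "q = cell (lf y) y" using q by (auto simp: m_def)
    show "disjnt p q"
    proof (rule ccontr)
      assume "\<not> disjnt p q"
      then obtain z where z: "z \<in> cell (lf x) x" "z \<in> cell (lf y) y" by (auto simp: disjnt_def x y)
      then have "lf x = lf y" using lf_eq[of z x] lf_eq[of z y] by simp
      then have "p = q" using eq[OF z(1)] eq[OF z(2)] by (simp add: x y)
      with neq show False ..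
    qed
  qed
  \<comment> \<open>For \<open>I\<close> in \<open>\<Lambda> j\<close>, \<open>Ch i I\<close>
    collects the children, of level \<open>i\<close>, of the ancestor of \<open>I\<close> of level
    \<open>i - 1\<close>. As \<open>i\<close> runs over \<open>{i0<..j}\<close> there are
    \<open>j - i0\<close> such ancestors with at most \<open>c\<close> children each, which gives
    the count.\<close>
  define rep where "rep I = (SOME z. z \<in> I)" for I :: "'a set"
  define Ch where "Ch i I = cell i ` cell (i - 1) (rep I)" for i I
  define U where "U j = (\<Union>i\<in>{i0<..j}. \<Union>I\<in>\<Lambda> j. Ch i I)" for j
  have fin\<Lambda>: "finite (\<Lambda> j)" for j by (rule finite_subset[OF \<Lambda> fin])
  have finCh: "finite (Ch i I)" for i I
    unfolding Ch_def by (rule finite_subset[OF image_mono[OF sub] fin])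
  \<comment> \<open>A leaf finer than \<open>i0\<close> has a parent that is not good. The parent
    then contains some cell of \<open>\<Lambda> j\<close>, and the leaf is a child of an ancestor of
    that cell.\<close>
  have "m \<subseteq> cell i0 ` X \<union> (\<Union>j\<in>{i0<..J}. U j)"
  proof
    fix L assume "L \<in> m"
    then obtain x where x: "x \<in> X" "L = cell (lf x) x" by (auto simp: m_def)
    show "L \<in> cell i0 ` X \<union> (\<Union>j\<in>{i0<..J}. U j)"
    proof (cases "lf x = i0")
      case True
      then show ?thesis using x by auto
    next
      case False
      define i where "i = lf x - 1"
      have i: "lf x = Suc i" "i0 \<le> i" using False lf(1)[of x] by (auto simp: i_def)
      then have "\<not> good i x" using not_good by auto
      then obtain y j where y: "y \<in> cell i x" "i < j" "j \<le> J" "cell j y \<in> \<Lambda> j"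
        by (auto simp: good_def)
      have "y \<in> cell j y" using y(1) sub self by blast
      then have "rep (cell j y) \<in> cell j y" unfolding rep_def by (rule someI)
      then have "rep (cell j y) \<in> cell i x" using mono'[of i j y] y eq[OF y(1)] by auto
      then have "x \<in> cell i (rep (cell j y))" using eq self[OF x(1)] by metis
      then have "L \<in> Ch (lf x) (cell j y)" unfolding Ch_def x(2) by (simp add: i)
      moreover have "lf x \<in> {i0<..j}" "j \<in> {i0<..J}" using i y by auto
      ultimately show ?thesis using y(4) unfolding U_def by blast
    qed
  qed
  moreover have finU: "finite (U j)" for j unfolding U_def using fin\<Lambda> finCh by auto
  ultimately have finm: "finite m" and "card m \<le> card (cell i0 ` X \<union> (\<Union>j\<in>{i0<..J}. U j))"
    using fin by (auto intro: finite_subset card_mono)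
  note this(2)
  also have "\<dots> \<le> card (cell i0 ` X) + card (\<Union>j\<in>{i0<..J}. U j)" by (rule card_Un_le)
  also have "card (\<Union>j\<in>{i0<..J}. U j) \<le> (\<Sum>j\<in>{i0<..J}. card (U j))" by (rule card_UN_le) simp
  also have "\<dots> \<le> (\<Sum>j\<in>{i0<..J}. (j - i0) * (card (\<Lambda> j) * c))"
  proof (intro sum_mono)
    fix j assume j: "j \<in> {i0<..J}"
    have "card (U j) \<le> (\<Sum>i\<in>{i0<..j}. card (\<Union>I\<in>\<Lambda> j. Ch i I))"
      unfolding U_def by (rule card_UN_le) simp
    also have "\<dots> \<le> (\<Sum>i\<in>{i0<..j}. card (\<Lambda> j) * c)"
    proof (intro sum_mono)
      fix i assume i: "i \<in> {i0<..j}"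
      then have "Suc (i - 1) = i" by auto
      then have "card (Ch i I) \<le> c" for I using child[of "i - 1" "rep I"] by (simp add: Ch_def)
      then have "(\<Sum>I\<in>\<Lambda> j. card (Ch i I)) \<le> card (\<Lambda> j) * c"
        using sum_bounded_above[of "\<Lambda> j" "\<lambda>I. card (Ch i I)" c] by simp
      with card_UN_le[OF fin\<Lambda>[of j], of "Ch i"] show "card (\<Union>I\<in>\<Lambda> j. Ch i I) \<le> card (\<Lambda> j) * c" by simp
    qed
    finally show "card (U j) \<le> (j - i0) * (card (\<Lambda> j) * c)" by simp
  qed
  finally have "card m \<le> card (cell i0 ` X) + (\<Sum>j\<in>{i0<..J}. (j - i0) * (card (\<Lambda> j) * c))" by simp
  moreover have "cell j x \<notin> \<Lambda> j" if "x \<in> X" "lf x < j" "j \<le> J" for x j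
    using lf(2)[of x] self[OF that(1)] that by (auto simp: good_def)
  ultimately show ?thesis
    using part finm lf(1) lf_le lf_eq unfolding m_def by (intro that[of lf]) blast+
qed

section \<open>Piecewise polynomials on the unit cube\<close>

lemma borel_measurable_cube:
  "f \<in> borel_measurable borel \<Longrightarrow> f \<in> borel_measurable (cube_measure :: (real ^ 'n::finite) measure)"
  by (intro measurable_restrict_space1 measurable_completion) simp

lemma sets_cube:
  "I \<in> sets borel \<Longrightarrow> I \<subseteq> cbox 0 1 \<Longrightarrow> I \<in> sets (cube_measure :: (real ^ 'n::finite) measure)"
  by (auto simp: sets_restrict_space_iff)

lemma emeasure_cube: "emeasure cube_measure (space (cube_measure :: (real ^ 'n::finite) measure)) = 1"
proof -
  have "emeasure lborel (cbox 0 (1 :: real ^ 'n)) = ennreal (measure lborel (cbox 0 (1 :: real ^ 'n)))"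
    by (intro emeasure_eq_ennreal_measure) (use emeasure_lborel_cbox_finite[of "0 :: real ^ 'n" 1] in auto)
  also have "measure lborel (cbox 0 (1 :: real ^ 'n)) = 1"
    by (subst content_cbox_cart) (auto simp: interval_ne_empty_cart)
  finally show ?thesis by (simp add: emeasure_restrict_space)
qed

lemma nn_integral_cube:
  "(\<integral>\<^sup>+x. f x \<partial>cube_measure) = (\<integral>\<^sup>+x. f x * indicator (cbox 0 1) x \<partial>(lborel :: (real ^ 'n::finite) measure))"
  by (simp add: nn_integral_restrict_space nn_integral_completion)

lemma borel_measurable_piecewise_poly:
  assumes f: "f \<in> piecewise_poly r m" and m: "finite m" "partition_on (cbox 0 1) m" "m \<subseteq> sets borel"
  shows "f \<in> borel_measurable (cube_measure :: (real ^ 'n::finite) measure)"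
proof (rule measurable_piecewise_restrict[of m])
  show "countable m" using m(1) by (rule countable_finite)
  show "space cube_measure \<subseteq> \<Union> m" using partition_onD1[OF m(2)] by simp
  fix I assume I: "I \<in> m"
  then have sub: "I \<subseteq> cbox 0 1" using partition_onD1[OF m(2)] by auto
  then show "I \<inter> space cube_measure \<in> sets cube_measure"
    using sets_cube[of I] I m(3) by (auto simp: Int_absorb2)
  obtain g where g: "g \<in> box_polynomials r" "\<And>x. x \<in> I \<Longrightarrow> f x = g x"
    using f I by (auto simp: piecewise_poly_iff)
  have "g \<in> borel_measurable (restrict_space cube_measure I)"
    using g(1) by (intro measurable_restrict_space1 borel_measurable_cube borel_measurable_box_polynomial)
  then show "f \<in> borel_measurable (restrict_space cube_measure I)"
    by (rule measurable_cong[THEN iffD1, rotated]) (auto simp: g space_restrict_space)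
qed

text \<open>The supremum bound on a cell, whose volume is 2 to the power minus the sum of its
  levels. The function \<open>g\<close> only has to agree with a polynomial on this cell, which fits
  piecewise polynomials; \<open>C\<close> is uniform in the levels.\<close>

lemma box_polynomial_cell_le:
  fixes r :: "'n::finite \<Rightarrow> nat"
  assumes "0 < p"
  shows "\<exists>C>0. \<forall>f\<in>box_polynomials r. \<forall>j. \<forall>x\<in>cbox 0 1. \<forall>g. (\<forall>y\<in>dyadic_cell j x. g y = f y) \<longrightarrow>
      ennreal (\<bar>g x\<bar> powr p) \<le> ennreal (C * 2 ^ (\<Sum>l\<in>UNIV. j l))
        * (\<integral>\<^sup>+y. ennreal (\<bar>g y\<bar> powr p) * indicator (dyadic_cell j x) y \<partial>cube_measure)"
proof -
  obtain C where "0 < C \<and> (\<forall>f\<in>box_polynomials r. \<forall>a b. \<forall>x\<in>cbox a b. (\<forall>l. a $ l < b $ l) \<longrightarrow>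
     ennreal (\<bar>f x\<bar> powr p * (\<Prod>l\<in>UNIV. b $ l - a $ l))
       \<le> ennreal C * (\<integral>\<^sup>+y. ennreal (\<bar>f y\<bar> powr p) * indicator (box a b) y \<partial>lborel))"
    using box_polynomial_sup_le[OF assms, of r] ..
  note C0 = conjunct1[OF this] and C = conjunct2[OF this]
  show ?thesis
  proof (intro exI[of _ C] conjI ballI allI impI C0)
    fix f g :: "real ^ 'n \<Rightarrow> real" and j x
    assume f: "f \<in> box_polynomials r" and x: "x \<in> cbox 0 1" and "\<forall>y\<in>dyadic_cell j x. g y = f y"
    then have fg: "\<And>y. y \<in> dyadic_cell j x \<Longrightarrow> g y = f y" by blast
    obtain a b where ab': "(\<forall>l. b $ l - a $ l = (1/2) ^ j l) \<and> box a b \<subseteq> dyadic_cell j x \<and> dyadic_cell j x \<subseteq> cbox a b"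
      using dyadic_cell_between_boxes[OF x, of j] by (elim exE)
    then have ab: "\<And>l. b $ l - a $ l = (1/2) ^ j l" "box a b \<subseteq> dyadic_cell j x" "dyadic_cell j x \<subseteq> cbox a b"
      by simp_all
    define N where "N = (\<Sum>l\<in>UNIV. j l)"
    have N: "(\<Prod>l\<in>UNIV. b $ l - a $ l) = (1/2) ^ N" by (simp add: ab(1) power_sum N_def)
    have xab: "x \<in> cbox a b" using ab(3) dyadic_cell_self[OF x] by auto
    have lt: "a $ l < b $ l" for l 
    proof -
      have "0 < b $ l - a $ l" by (simp add: ab(1))
      then show ?thesis by simp
    qed
    have "ennreal (\<bar>f x\<bar> powr p) = ennreal (2 ^ N) * ennreal (\<bar>f x\<bar> powr p * (1/2) ^ N)"
      by (simp add: power_one_over flip: ennreal_mult)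
    also have "\<dots> \<le> ennreal (2 ^ N) * (ennreal C * (\<integral>\<^sup>+y. ennreal (\<bar>f y\<bar> powr p) * indicator (box a b) y \<partial>lborel))"
      using C[rule_format, OF f xab lt] unfolding N by (intro mult_left_mono) auto
    also have "(\<integral>\<^sup>+y. ennreal (\<bar>f y\<bar> powr p) * indicator (box a b) y \<partial>lborel)
        \<le> (\<integral>\<^sup>+y. ennreal (\<bar>g y\<bar> powr p) * indicator (dyadic_cell j x) y * indicator (cbox 0 1) y \<partial>lborel)"
      using ab(2) dyadic_cell_subset[of j x] fg
      by (intro nn_integral_mono) (auto split: split_indicator)
    finally have "ennreal (\<bar>f x\<bar> powr p) \<le> ennreal (2 ^ N) * (ennreal C *
        (\<integral>\<^sup>+y. ennreal (\<bar>g y\<bar> powr p) * indicator (dyadic_cell j x) y \<partial>cube_measure))"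
      by (simp add: nn_integral_cube mult_left_mono)
    then show "ennreal (\<bar>g x\<bar> powr p) \<le> ennreal (C * 2 ^ (\<Sum>l\<in>UNIV. j l))
        * (\<integral>\<^sup>+y. ennreal (\<bar>g y\<bar> powr p) * indicator (dyadic_cell j x) y \<partial>cube_measure)"
      using C0 fg[OF dyadic_cell_self[OF x]] by (simp add: N_def ennreal_mult mult_ac)
  qed
qed

section \<open>Counting large cells and summing over levels\<close>

text \<open>Markov's inequality for a disjoint family: the integrals over distinct members add up to
  at most the total integral.\<close>

lemma card_large_integral_le:
  fixes f :: "'a \<Rightarrow> ennreal"
  assumes "finite m" "disjoint m" "m \<subseteq> sets M" and [measurable]: "f \<in> borel_measurable M"
    and "(\<integral>\<^sup>+x. f x \<partial>M) \<le> ennreal A" "0 \<le> A" "0 \<le> t"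
  shows "real (card {I \<in> m. ennreal t < (\<integral>\<^sup>+x. f x * indicator I x \<partial>M)}) * t \<le> A"
proof -
  let ?L = "{I \<in> m. ennreal t < (\<integral>\<^sup>+x. f x * indicator I x \<partial>M)}"
  have L: "finite ?L" using assms(1) by auto
  have meas: "(\<lambda>x. f x * indicator I x) \<in> borel_measurable M" if "I \<in> ?L" for I
    using that assms(3) by auto
  have "ennreal (real (card ?L) * t) = (\<Sum>I\<in>?L. ennreal t)"
    using \<open>0 \<le> t\<close> by (simp add: ennreal_mult ennreal_of_nat_eq_real_of_nat)
  also have "\<dots> \<le> (\<Sum>I\<in>?L. \<integral>\<^sup>+x. f x * indicator I x \<partial>M)"
    by (intro sum_mono) (auto intro: less_imp_le)
  also have "\<dots> = (\<integral>\<^sup>+x. (\<Sum>I\<in>?L. f x * indicator I x) \<partial>M)"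
    using meas by (intro nn_integral_sum[symmetric]) auto
  also have "\<dots> \<le> (\<integral>\<^sup>+x. f x \<partial>M)"
  proof (intro nn_integral_mono)
    fix x
    show "(\<Sum>I\<in>?L. f x * indicator I x) \<le> f x"
    proof (cases "x \<in> \<Union>?L")
      case True
      then obtain K where K: "K \<in> ?L" "x \<in> K" by blast
      have "x \<notin> I" if "I \<in> ?L - {K}" for I
        using assms(2) that K by (auto simp: disjoint_def)
      then have "(\<Sum>I\<in>?L - {K}. f x * indicator I x) = 0" by (intro sum.neutral) auto
      then show ?thesis using sum.remove[OF L K(1), of "\<lambda>I. f x * indicator I x"] K(2) by simp
    next
      case False
      then have "(\<Sum>I\<in>?L. f x * indicator I x) = 0" by (intro sum.neutral) auto
      then show ?thesis by simp
    qed
  qed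
  also have "\<dots> \<le> ennreal A" by fact
  finally show ?thesis using assms by (simp add: ennreal_le_iff)
qed

lemma sum_power_le_geometric:
  fixes y :: real
  assumes "0 \<le> y" "y < 1" "finite A" "\<And>i. i \<in> A \<Longrightarrow> J \<le> i"
  shows "(\<Sum>i\<in>A. y ^ i) \<le> y ^ J / (1 - y)"
proof -
  have inj: "inj_on (\<lambda>i. i - J) A" using assms(4) by (auto simp: inj_on_def) (metis le_add_diff_inverse)
  have "(\<Sum>i\<in>A. y ^ i) = (\<Sum>i\<in>A. y ^ J * y ^ (i - J))"
    using assms(4) by (intro sum.cong) (auto simp flip: power_add)
  also have "\<dots> = y ^ J * (\<Sum>i\<in>(\<lambda>i. i - J) ` A. y ^ i)"
    by (simp add: sum_distrib_left sum.reindex[OF inj])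
  also have "(\<Sum>i\<in>(\<lambda>i. i - J) ` A. y ^ i) \<le> (\<Sum>i. y ^ i)"
    using assms by (intro sum_le_suminf summable_geometric) auto
  also have "\<dots> = 1 / (1 - y)" using assms by (intro suminf_geometric) auto
  finally show ?thesis using assms by (simp add: mult_left_mono)
qed

lemma approx_error_lessD:
  assumes "approx_error r p m s < c"
  obtains t where "t \<in> piecewise_poly r m" "Lp_norm cube_measure p (\<lambda>x. s x - t x) \<le> c"
  using assms by (auto simp: approx_error_def INF_less_iff less_imp_le)

section \<open>Anisotropic levels: growth, nesting and sidelengths\<close>

definition aniso_level :: "('n::finite \<Rightarrow> real) \<Rightarrow> nat \<Rightarrow> 'n \<Rightarrow> nat" where
  "aniso_level \<sigma> j l = nat \<lfloor>real j * min_smoothness \<sigma> / \<sigma> l\<rfloor>"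

text \<open>The growth exponent of the number of cells: level \<open>j\<close> has at most 2 to the
  power \<open>j * aniso_rate \<sigma>\<close> of them. It equals d times the smallest smoothness
  over the harmonic mean.\<close>

definition aniso_rate :: "('n::finite \<Rightarrow> real) \<Rightarrow> real" where
  "aniso_rate \<sigma> = (\<Sum>l\<in>UNIV. min_smoothness \<sigma> / \<sigma> l)"

lemma aniso_partition_eq: "aniso_partition \<sigma> j = dyadic_rectangles (aniso_level \<sigma> j)"
  by (simp add: aniso_partition_def aniso_level_def[abs_def])

context
  fixes \<sigma> :: "'n::finite \<Rightarrow> real"
  assumes \<sigma>: "\<And>l. 0 < \<sigma> l"
begin

lemma min_smoothness_pos: "0 < min_smoothness \<sigma>"
  using \<sigma> by (auto simp: min_smoothness_def Min_gr_iff)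

lemma min_smoothness_le: "min_smoothness \<sigma> \<le> \<sigma> l"
  by (simp add: min_smoothness_def)

lemma harmonic_mean_pos: "0 < harmonic_mean \<sigma>"
  using \<sigma> by (auto simp: harmonic_mean_def intro!: divide_pos_pos mult_pos_pos sum_pos)

lemma aniso_rate_eq: "aniso_rate \<sigma> = real CARD('n) * min_smoothness \<sigma> / harmonic_mean \<sigma>"
  by (simp add: aniso_rate_def harmonic_mean_def sum_distrib_left sum_divide_distrib field_simps)

lemma aniso_rate_pos: "0 < aniso_rate \<sigma>"
  using harmonic_mean_pos min_smoothness_pos by (simp add: aniso_rate_eq)

text \<open>The ratio \<open>min_smoothness \<sigma> / \<sigma> l\<close> lies between 0 and 1, so
  the floor grows by 0 or 1 per step. Hence successive partitions are nested and a cell has at most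
  \<open>2 ^ CARD('n)\<close> children.\<close>

lemma aniso_level_Suc: "aniso_level \<sigma> j l \<le> aniso_level \<sigma> (Suc j) l" "aniso_level \<sigma> (Suc j) l \<le> Suc (aniso_level \<sigma> j l)"
proof -
  define a where "a = min_smoothness \<sigma> / \<sigma> l"
  have a: "0 \<le> a" "a \<le> 1" using min_smoothness_pos min_smoothness_le[of l] \<sigma>[of l] by (auto simp: a_def)
  have eq: "aniso_level \<sigma> i l = nat \<lfloor>real i * a\<rfloor>" for i by (simp add: aniso_level_def a_def)
  have "real (Suc j) * a = real j * a + a" by (simp add: algebra_simps)
  then have "\<lfloor>real j * a\<rfloor> \<le> \<lfloor>real (Suc j) * a\<rfloor>" "\<lfloor>real (Suc j) * a\<rfloor> \<le> \<lfloor>real j * a\<rfloor> + 1"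
    using a by linarith+
  moreover have "0 \<le> \<lfloor>real j * a\<rfloor>" using a by simp
  ultimately show "aniso_level \<sigma> j l \<le> aniso_level \<sigma> (Suc j) l" "aniso_level \<sigma> (Suc j) l \<le> Suc (aniso_level \<sigma> j l)"
    unfolding eq by linarith+
qed

lemma real_aniso_level_le: "real (aniso_level \<sigma> j l) \<le> real j * min_smoothness \<sigma> / \<sigma> l"
proof -
  have "0 \<le> real j * min_smoothness \<sigma> / \<sigma> l" using min_smoothness_pos \<sigma>[of l] by simp
  then show ?thesis unfolding aniso_level_def by simp
qed

lemma sum_aniso_level_le: "2 ^ (\<Sum>l\<in>UNIV. aniso_level \<sigma> j l) \<le> (2::real) powr (real j * aniso_rate \<sigma>)"
proof -
  have "real (\<Sum>l\<in>UNIV. aniso_level \<sigma> j l) \<le> real j * aniso_rate \<sigma>"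
    using sum_mono[of UNIV "\<lambda>l. real (aniso_level \<sigma> j l)" "\<lambda>l. real j * min_smoothness \<sigma> / \<sigma> l"] real_aniso_level_le
    by (simp add: aniso_rate_def sum_distrib_left)
  then have "2 powr real (\<Sum>l\<in>UNIV. aniso_level \<sigma> j l) \<le> (2::real) powr (real j * aniso_rate \<sigma>)"
    by (intro powr_mono) auto
  then show ?thesis by (simp only: powr_realpow zero_less_numeral)
qed

lemma card_aniso_partition_le: "real (card (aniso_partition \<sigma> j)) \<le> 2 powr (real j * aniso_rate \<sigma>)"
proof -
  have "real (card (aniso_partition \<sigma> j)) \<le> 2 ^ (\<Sum>l\<in>UNIV. aniso_level \<sigma> j l)"
    using card_dyadic_rectangles(2)[of "aniso_level \<sigma> j"] unfolding aniso_partition_eq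
    by (metis of_nat_le_iff of_nat_numeral of_nat_power)
  with sum_aniso_level_le show ?thesis by (rule order.trans[rotated])
qed

lemma aniso_level_sidelength:
  assumes "i \<le> J"
  shows "2 powr (- (real J * min_smoothness \<sigma> / \<sigma> l)) \<le> (1/2) ^ aniso_level \<sigma> i l"
proof -
  have "real (aniso_level \<sigma> i l) \<le> real i * min_smoothness \<sigma> / \<sigma> l" by (rule real_aniso_level_le)
  also have "\<dots> \<le> real J * min_smoothness \<sigma> / \<sigma> l"
    using assms \<sigma>[of l] min_smoothness_pos by (intro divide_right_mono mult_right_mono) (auto intro: less_imp_le)
  finally have "2 powr (- (real J * min_smoothness \<sigma> / \<sigma> l)) \<le> (2::real) powr (- real (aniso_level \<sigma> i l))"
    by (intro powr_mono) auto
  also have "\<dots> = (1/2) ^ aniso_level \<sigma> i l" by (simp add: powr_minus powr_realpow power_one_over field_simps)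
  finally show ?thesis .
qed

end

section \<open>Adaptive approximation\<close>

text \<open>Above \<open>J\<close> the threshold is 1 and the terms decay at the full rate
  \<open>\<beta>\<close>. Up to \<open>J\<close> the growth of \<open>\<theta>\<close>, raised to
  the power \<open>\<delta>\<close>, uses half of \<open>\<beta>\<close>, leaving a geometric series
  of rate \<open>\<beta> / 2\<close> from \<open>j0\<close> on; the volume factor at
  \<open>j0\<close> is cancelled by \<open>2 powr (- kd)\<close> because
  \<open>j0 * a \<le> kd\<close>.\<close>

lemma threshold_sum_le:
  fixes a \<mu> \<beta> \<delta> K kd :: real and j0 J :: nat
  assumes \<beta>: "\<beta> = \<mu> - a * \<delta>" "0 < \<beta>" and "0 < \<delta>" "0 < K" and j0: "real j0 * a \<le> kd"
  defines "\<theta> \<equiv> \<lambda>j. if j \<le> J then K * 2 powr ((real j - real j0) * (\<beta> / (2 * \<delta>)) - kd) else 1"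
  shows "(\<Sum>i<n. 2 powr (- (real (Suc (min j0 J + i)) * \<mu>))
            * (2 powr (real (Suc (min j0 J + i)) * a) * \<theta> (Suc (min j0 J + i))) powr \<delta>)
    \<le> K powr \<delta> / (1 - 2 powr (- (\<beta> / 2))) * 2 powr (- (real j0 * \<mu>))
      + 1 / (1 - 2 powr (- \<beta>)) * 2 powr (- (real J * \<beta>))"
proof -
  define x where "x = 2 powr (- (\<beta> / 2))"
  define y where "y = 2 powr (- \<beta>)"
  define b where "b j = 2 powr (- (real j * \<mu>)) * (2 powr (real j * a) * \<theta> j) powr \<delta>" for j
  have xy: "0 < x" "x < 1" "0 < y" "y < 1" 
    using \<open>0 < \<beta>\<close> powr_less_mono[of "- (\<beta> / 2)" 0 "2::real"] powr_less_mono[of "- \<beta>" 0 "2::real"]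
    by (simp_all add: x_def y_def)
  have y_pow: "y ^ j = 2 powr (- (real j * \<beta>))" for j
    by (simp add: y_def powr_powr mult.commute flip: powr_realpow)
  have x_pow: "x ^ j = 2 powr (- (real j * (\<beta> / 2)))" for j
    by (simp add: x_def powr_powr mult.commute flip: powr_realpow)
  define E where "E = K powr \<delta> * 2 powr (- (real j0 * \<mu>))"
  have fine: "b j = y ^ j" if "J < j" for j
  proof -
    have "b j = 2 powr (- (real j * \<mu>) + real j * a * \<delta>)"
      using that by (simp add: b_def \<theta>_def powr_powr flip: powr_add)
    also have "- (real j * \<mu>) + real j * a * \<delta> = - (real j * \<beta>)"
      by (simp add: \<beta>(1) algebra_simps)
    finally show ?thesis by (simp add: y_pow)
  qed
  have coarse: "b j \<le> E / x ^ j0 * x ^ j" if "j \<le> J" "j0 < j" for j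
  proof -
    have "\<theta> j powr \<delta> = K powr \<delta> * 2 powr ((real j - real j0) * (\<beta> / 2) - kd * \<delta>)"
    proof -
      have "((real j - real j0) * (\<beta> / (2 * \<delta>)) - kd) * \<delta> = (real j - real j0) * (\<beta> / 2) - kd * \<delta>"
        using \<open>0 < \<delta>\<close> by (simp add: field_simps)
      then show ?thesis using that(1) \<open>0 < K\<close> by (simp only: \<theta>_def if_True powr_mult powr_powr)
    qed
    moreover have "0 \<le> \<theta> j" using \<open>0 < K\<close> by (simp add: \<theta>_def)
    ultimately have "b j = K powr \<delta> * (2 powr (- (real j * \<mu>)) * 2 powr (real j * a * \<delta>)
        * 2 powr ((real j - real j0) * (\<beta> / 2) - kd * \<delta>))"
      by (simp add: b_def powr_mult powr_powr)
    also have "\<dots> = K powr \<delta> * 2 powr (- (real j * \<mu>) + real j * a * \<delta> + ((real j - real j0) * (\<beta> / 2) - kd * \<delta>))"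
      by (simp only: powr_add)
    also have "\<dots> \<le> K powr \<delta> * 2 powr (- (real j0 * \<mu>) + (real j0 * (\<beta> / 2) - real j * (\<beta> / 2)))"
    proof -
      have "real j0 * a * \<delta> \<le> kd * \<delta>" using j0 \<open>0 < \<delta>\<close> by simp
      moreover have "real j * \<mu> = real j * \<beta> + real j * a * \<delta>" "real j0 * \<mu> = real j0 * \<beta> + real j0 * a * \<delta>"
        by (simp_all add: \<beta>(1) algebra_simps)
      moreover have "(real j - real j0) * (\<beta> / 2) = real j * \<beta> / 2 - real j0 * \<beta> / 2"
        by (simp add: left_diff_distrib diff_divide_distrib)
      ultimately have "- (real j * \<mu>) + real j * a * \<delta> + ((real j - real j0) * (\<beta> / 2) - kd * \<delta>)
          \<le> - (real j0 * \<mu>) + (real j0 * (\<beta> / 2) - real j * (\<beta> / 2))"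
        by linarith
      then show ?thesis by (intro mult_left_mono powr_mono) auto
    qed
    also have "\<dots> = E * 2 powr (real j0 * (\<beta> / 2) - real j * (\<beta> / 2))"
      by (simp only: E_def powr_add mult.assoc)
    also have "2 powr (real j0 * (\<beta> / 2) - real j * (\<beta> / 2)) = x ^ j / x ^ j0"
      unfolding x_pow powr_diff[symmetric] by simp
    also have "E * (x ^ j / x ^ j0) = E / x ^ j0 * x ^ j" by simp
    finally show ?thesis .
  qed
  let ?I = "(\<lambda>i. Suc (min j0 J + i)) ` {..<n}"
  have "(\<Sum>i<n. b (Suc (min j0 J + i))) = sum b ?I"
    by (subst sum.reindex) (auto simp: inj_on_def)
  also have "\<dots> = sum b {j \<in> ?I. j \<le> J} + sum b {j \<in> ?I. J < j}"
    by (subst sum.union_disjoint[symmetric]) (auto intro!: sum.cong)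
  \<comment> \<open>An index exceeds \<open>min j0 J\<close>; if it is also at most
    \<open>J\<close>, then it exceeds \<open>j0\<close>, so \<open>coarse\<close> applies. For
    \<open>J \<le> j0\<close> this part is empty.\<close>
  also have "sum b {j \<in> ?I. j \<le> J} \<le> (\<Sum>j\<in>{j \<in> ?I. j \<le> J}. E / x ^ j0 * x ^ j)"
    by (intro sum_mono coarse) auto
  also have "\<dots> \<le> E / x ^ j0 * (x ^ j0 / (1 - x))"
    unfolding sum_distrib_left[symmetric] using xy
    by (intro mult_left_mono sum_power_le_geometric) (auto simp: E_def)
  also have "\<dots> = K powr \<delta> / (1 - x) * 2 powr (- (real j0 * \<mu>))" using xy by (simp add: E_def)
  also have "sum b {j \<in> ?I. J < j} = (\<Sum>j\<in>{j \<in> ?I. J < j}. y ^ j)"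
    by (intro sum.cong fine) auto
  also have "\<dots> \<le> y ^ J / (1 - y)"
    using xy by (intro sum_power_le_geometric) auto
  finally show ?thesis by (simp add: b_def x_def y_pow) (simp add: y_def)
qed

text \<open>Comparison with the derivative of the geometric series, after enlarging
  \<open>real n\<close> to \<open>real (Suc n)\<close>.\<close>

lemma sum_mult_power_le:
  fixes z :: real
  assumes "0 \<le> z" "z < 1"
  shows "(\<Sum>j\<in>{i<..J}. real (j - i) * z ^ (j - i)) \<le> 1 / (1 - z)\<^sup>2"
proof -
  have sums: "(\<lambda>n. real (Suc n) * z ^ n) sums (1 / (1 - z)\<^sup>2)"
    using geometric_deriv_sums[of z] assms by simp
  have "(\<Sum>j\<in>{i<..J}. real (j - i) * z ^ (j - i)) = (\<Sum>n\<in>(\<lambda>j. j - i) ` {i<..J}. real n * z ^ n)"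
    by (subst sum.reindex) (auto simp: inj_on_def)
  also have "\<dots> \<le> (\<Sum>n\<in>(\<lambda>j. j - i) ` {i<..J}. real (Suc n) * z ^ n)"
    using assms by (intro sum_mono mult_right_mono) auto
  also have "\<dots> \<le> (\<Sum>n. real (Suc n) * z ^ n)"
    using sums assms by (intro sum_le_suminf) (auto simp: sums_iff)
  finally show ?thesis using sums by (simp add: sums_iff)
qed

text \<open>Doubling the bound makes the inequality for the infimum strict, since
  \<open>R > 0\<close>, and so some piecewise polynomial satisfies it without any appeal to
  attainment.\<close>

lemma near_best_approximation:
  assumes "0 < R" and err: "\<And>j. approx_error r q (D j) s \<le> ennreal (R * 2 powr (- (real j * \<mu>)))"
  obtains P where "\<And>j. P j \<in> piecewise_poly r (D j)"
    "\<And>j. Lp_norm cube_measure q (\<lambda>x. s x - P j x) \<le> ennreal (2 * R * 2 powr (- (real j * \<mu>)))"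
proof -
  have "\<exists>t. t \<in> piecewise_poly r (D j) \<and>
     Lp_norm cube_measure q (\<lambda>x. s x - t x) \<le> ennreal (2 * R * 2 powr (- (real j * \<mu>)))" for j
  proof -
    have "approx_error r q (D j) s < ennreal (2 * R * 2 powr (- (real j * \<mu>)))"
      using \<open>0 < R\<close> by (intro le_less_trans[OF err ennreal_lessI]) auto
    then show ?thesis by (elim approx_error_lessD) blast
  qed
  then show ?thesis using that by metis
qed

text \<open>The level \<open>j0\<close> balances the cell budget: \<open>H / \<mu>\<close> times the
  growth rate is the dimension, so level \<open>j0\<close> has at most 2 to the power
  \<open>k d\<close> cells. Rounding down loses less than one level, hence the factor
  \<open>2 powr min_smoothness \<sigma>\<close>.\<close>

lemma floor_scale_bounds:
  fixes \<sigma> :: "'n::finite \<Rightarrow> real" and k :: nat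
  assumes \<sigma>: "\<And>l. 0 < \<sigma> l"
  defines "j0 \<equiv> nat \<lfloor>real k * harmonic_mean \<sigma> / min_smoothness \<sigma>\<rfloor>"
  shows "real j0 * aniso_rate \<sigma> \<le> real (k * CARD('n))"
    "2 powr (- (real j0 * min_smoothness \<sigma>)) \<le> 2 powr min_smoothness \<sigma> * (2::real) powr (- (real k * harmonic_mean \<sigma>))"
proof -
  note H = harmonic_mean_pos[of \<sigma>, OF \<sigma>] and \<mu> = min_smoothness_pos[of \<sigma>, OF \<sigma>]
  have "0 \<le> real k * harmonic_mean \<sigma> / min_smoothness \<sigma>" using H \<mu> by simp
  then have j0: "real j0 \<le> real k * harmonic_mean \<sigma> / min_smoothness \<sigma>"
    "real k * harmonic_mean \<sigma> / min_smoothness \<sigma> \<le> real j0 + 1"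
    unfolding j0_def by linarith+
  have "real j0 * aniso_rate \<sigma> \<le> real k * harmonic_mean \<sigma> / min_smoothness \<sigma> * aniso_rate \<sigma>"
    using j0(1) aniso_rate_pos[of \<sigma>, OF \<sigma>] by (intro mult_right_mono) auto
  also have "\<dots> = real (k * CARD('n))" using H \<mu> by (simp add: aniso_rate_eq[of \<sigma>, OF \<sigma>])
  finally show "real j0 * aniso_rate \<sigma> \<le> real (k * CARD('n))" .
  have "real k * harmonic_mean \<sigma> \<le> (real j0 + 1) * min_smoothness \<sigma>"
    using j0(2) \<mu> by (simp add: field_simps)
  then have "2 powr (- (real j0 * min_smoothness \<sigma>)) \<le> (2::real) powr (min_smoothness \<sigma> + - (real k * harmonic_mean \<sigma>))"
    by (intro powr_mono) (auto simp: algebra_simps)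
  then show "2 powr (- (real j0 * min_smoothness \<sigma>)) \<le> 2 powr min_smoothness \<sigma> * (2::real) powr (- (real k * harmonic_mean \<sigma>))"
    by (simp only: powr_add)
qed

lemma card_aniso_partition_coarse_le:
  fixes \<sigma> :: "'n::finite \<Rightarrow> real"
  assumes \<sigma>: "\<And>l. 0 < \<sigma> l" and "i \<le> nat \<lfloor>real k * harmonic_mean \<sigma> / min_smoothness \<sigma>\<rfloor>"
  shows "real (card (aniso_partition \<sigma> i)) \<le> 2 ^ (k * CARD('n))"
proof -
  have "real i * aniso_rate \<sigma> \<le> real (nat \<lfloor>real k * harmonic_mean \<sigma> / min_smoothness \<sigma>\<rfloor>) * aniso_rate \<sigma>"
    using assms(2) aniso_rate_pos[of \<sigma>, OF \<sigma>] by (intro mult_right_mono) auto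
  also have "\<dots> \<le> real (k * CARD('n))" by (rule floor_scale_bounds[of \<sigma> k, OF \<sigma>])
  finally have "2 powr (real i * aniso_rate \<sigma>) \<le> (2::real) powr real (k * CARD('n))"
    by (intro powr_mono) auto
  with card_aniso_partition_le[of \<sigma> i, OF \<sigma>] show ?thesis
    by (simp only: powr_realpow zero_less_numeral)
qed

lemma aniso_partition_measurable:
  "finite (aniso_partition \<sigma> j)" "partition_on (cbox 0 1) (aniso_partition \<sigma> j)"
  "aniso_partition \<sigma> j \<subseteq> sets borel"
  using card_dyadic_rectangles(1) partition_on_dyadic_rectangles dyadic_cell_borel
  by (auto simp: aniso_partition_eq dyadic_rectangles_eq)

lemma telescope_abs_le:
  fixes P :: "nat \<Rightarrow> real"
  assumes "l \<le> n"
  shows "\<bar>P n - P l\<bar> \<le> (\<Sum>j\<in>{l<..n}. \<bar>P j - P (j - 1)\<bar>)"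
  using assms
proof (induction n rule: dec_induct)
  case (step n)
  have "{l<..Suc n} = insert (Suc n) {l<..n}" using step by auto
  then show ?case using step by simp
qed simp

section \<open>The adaptive construction for p < q\<close>

text \<open>\<open>\<beta>\<close> is the decay left after passing from L_p to L_q, which costs
  \<open>aniso_rate \<sigma>\<close> times 1/p - 1/q per level. Its positivity is the assumption on
  H/d multiplied by \<open>aniso_rate \<sigma>\<close>. The constant \<open>C\<close> is fixed
  before \<open>J\<close>, \<open>k\<close>, \<open>R\<close> and \<open>s\<close>.\<close>

lemma adaptive_approximation:
  fixes r :: "'n::finite \<Rightarrow> nat" and \<sigma> :: "'n \<Rightarrow> real" and p :: real and q :: ennreal
  defines "\<mu> \<equiv> min_smoothness \<sigma>" and "H \<equiv> harmonic_mean \<sigma>" and "e \<equiv> enn2real (1 / q)"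
  defines "\<beta> \<equiv> \<mu> - aniso_rate \<sigma> * (1 / p - e)"
  assumes \<sigma>: "\<And>l. 0 < \<sigma> l" and "0 < p" "1 \<le> q" "ennreal p \<le> q" and "e < 1 / p" and "0 < \<beta>"
  shows "\<exists>C>0. \<forall>J k R s. 0 < R \<longrightarrow> s \<in> borel_measurable cube_measure \<longrightarrow>
     (\<forall>j. approx_error r (ennreal p) (aniso_partition \<sigma> j) s \<le> ennreal (R * 2 powr (- (real j * \<mu>)))) \<longrightarrow>
     (\<exists>m. finite m \<and> partition_on (cbox 0 1) m \<and> m \<subseteq> (\<Union>i\<le>J. aniso_partition \<sigma> i)
        \<and> real (card m) \<le> 2 * 2 ^ (k * CARD('n))
        \<and> approx_error r q m s \<le> ennreal (C * R * (2 powr (- (real J * \<beta>)) + 2 powr (- (real k * H)))))"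
proof -
  define a where "a = aniso_rate \<sigma>"
  define \<delta> where "\<delta> = 1 / p - e"
  have \<delta>: "0 < \<delta>" "\<beta> = \<mu> - a * \<delta>" using \<open>e < 1 / p\<close> by (auto simp: \<delta>_def \<beta>_def a_def)
  have \<mu>: "0 < \<mu>" unfolding \<mu>_def by (rule min_smoothness_pos[of \<sigma>, OF \<sigma>])
  have a: "0 < a" unfolding a_def by (rule aniso_rate_pos[of \<sigma>, OF \<sigma>])
  obtain CP where "0 < CP \<and> (\<forall>f\<in>box_polynomials r. \<forall>j. \<forall>x\<in>cbox 0 1. \<forall>g. (\<forall>y\<in>dyadic_cell j x. g y = f y) \<longrightarrow>
      ennreal (\<bar>g x\<bar> powr p) \<le> ennreal (CP * 2 ^ (\<Sum>l\<in>UNIV. j l))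
        * (\<integral>\<^sup>+y. ennreal (\<bar>g y\<bar> powr p) * indicator (dyadic_cell j x) y \<partial>cube_measure))"
    using box_polynomial_cell_le[OF \<open>0 < p\<close>, of r] ..
  note CP0 = conjunct1[OF this] and CP = conjunct2[OF this, rule_format]
  \<comment> \<open>Chosen so that the threshold, growing like 2 to the power \<open>\<eta>\<close>
    per level, costs exactly \<open>\<beta> / 2\<close> once raised to the power
    \<open>\<delta>\<close>.\<close>
  define \<eta> where "\<eta> = \<beta> / (2 * \<delta>)"
  define z where "z = 2 powr (- \<eta>)"
  have \<eta>: "0 < \<eta>" using \<open>0 < \<beta>\<close> \<delta> by (simp add: \<eta>_def)
  have z: "0 < z" "z < 1" using \<eta> powr_less_mono[of "- \<eta>" 0 "2::real"] by (simp_all add: z_def)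
  \<comment> \<open>Cancels both the number of children and the bound for the sum of
    \<open>n * z ^ n\<close>, so that large cells produce at most \<open>2 ^ (k * CARD('n))\<close>
    leaves.\<close>
  define K where "K = 2 ^ CARD('n) / (1 - z)\<^sup>2"
  have K: "0 < K" using z by (simp add: K_def)
  \<comment> \<open>The factor \<open>2 * 2 powr (1 / p)\<close> comes from the quasi-triangle
    inequality, the next 2 from near-best approximation, and \<open>2 powr \<mu>\<close> from
    bounding level \<open>j - 1\<close> in terms of level \<open>j\<close>.\<close>
  define c1 where "c1 = 2 * 2 powr (1 / p) * (2 * 2 powr \<mu>)"
  define c where "c = CP powr \<delta> * c1"
  have c1: "0 < c1" by (simp add: c1_def)
  then have c: "0 < c" using CP0 by (simp add: c_def)
  define B1 where "B1 = K powr \<delta> / (1 - 2 powr (- (\<beta> / 2)))"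
  define B2 where "B2 = 1 / (1 - 2 powr (- \<beta>))"
  have B: "0 < B1" "0 < B2"
    using \<open>0 < \<beta>\<close> K powr_less_mono[of "- (\<beta> / 2)" 0 "2::real"] powr_less_mono[of "- \<beta>" 0 "2::real"]
    by (simp_all add: B1_def B2_def)
  define C where "C = c * (B1 * 2 powr \<mu> + B2)"
  have C: "0 < C" using B c by (simp add: C_def add_pos_pos)
  show ?thesis
  proof (rule exI[of _ C], rule conjI[OF C], intro allI impI)
    fix J k :: nat and R :: real and s :: "real ^ 'n \<Rightarrow> real"
    assume R: "0 < R" and s: "s \<in> borel_measurable cube_measure"
      and err: "\<forall>j. approx_error r (ennreal p) (aniso_partition \<sigma> j) s \<le> ennreal (R * 2 powr (- (real j * \<mu>)))"
    define cell where "cell j = dyadic_cell (aniso_level \<sigma> j)" for j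
    define D where "D j = aniso_partition \<sigma> j" for j
    have D: "D j = cell j ` cbox 0 1" for j
      by (simp add: D_def cell_def aniso_partition_eq dyadic_rectangles_eq)
    have D_props: "finite (D j)" "partition_on (cbox 0 1) (D j)" "D j \<subseteq> sets borel" for j
      unfolding D_def by (rule aniso_partition_measurable)+
    have D_sets: "D j \<subseteq> sets cube_measure" for j
      using D_props(3)[of j] dyadic_cell_subset by (force simp: D cell_def intro!: sets_cube)
    obtain P where P: "\<And>j. P j \<in> piecewise_poly r (D j)"
      and P_err: "\<And>j. Lp_norm cube_measure (ennreal p) (\<lambda>x. s x - P j x) \<le> ennreal (2 * R * 2 powr (- (real j * \<mu>)))"
      using near_best_approximation[OF R, of r "ennreal p" D s \<mu>] err unfolding D_def by blast
    have P_int: "(\<integral>\<^sup>+x. ennreal (\<bar>s x - P j x\<bar> powr p) \<partial>cube_measure) \<le> ennreal ((2 * R * 2 powr (- (real j * \<mu>))) powr p)" for j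
      using P_err[of j] R \<open>0 < p\<close> by (simp add: Lp_norm_le_iff)
    note [measurable] = s
    have P_meas [measurable]: "P j \<in> borel_measurable cube_measure" for j
      by (rule borel_measurable_piecewise_poly[OF P D_props])
    define w where "w j x = P j x - P (j - 1) x" for j x
    have w_meas [measurable]: "w j \<in> borel_measurable cube_measure" for j
      unfolding w_def[abs_def] by measurable
    define A where "A j = (c1 * R * 2 powr (- (real j * \<mu>))) powr p" for j
    have A: "0 < A j" for j using c1 R by (simp add: A_def)
    have w_int: "(\<integral>\<^sup>+x. ennreal (\<bar>w j x\<bar> powr p) \<partial>cube_measure) \<le> ennreal (A j)" if "0 < j" for j
    proof -
      \<comment> \<open>The error bound of level \<open>j - 1\<close>, which also dominates the one
        of level \<open>j\<close>.\<close>
      define Z where "Z = 2 * R * 2 powr \<mu> * 2 powr (- (real j * \<mu>))"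
      have Z: "0 < Z" using R by (simp add: Z_def)
      have Z1: "2 * R * 2 powr (- (real (j - 1) * \<mu>)) = Z"
        using that by (simp add: Z_def of_nat_diff algebra_simps flip: powr_add)
      have Z2: "2 * R * 2 powr (- (real j * \<mu>)) \<le> Z"
        using R \<mu> ge_one_powr_ge_zero[of 2 \<mu>] by (simp add: Z_def)
      have "(\<integral>\<^sup>+x. ennreal (\<bar>(s x - P (j - 1) x) - (s x - P j x)\<bar> powr p) \<partial>cube_measure)
          \<le> ennreal (2 powr p * (Z powr p + Z powr p))"
      proof (rule nn_integral_powr_diff_le)
        show "(\<integral>\<^sup>+x. ennreal (\<bar>s x - P (j - 1) x\<bar> powr p) \<partial>cube_measure) \<le> ennreal (Z powr p)"
          using P_int[of "j - 1"] unfolding Z1 .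
        have "(2 * R * 2 powr (- (real j * \<mu>))) powr p \<le> Z powr p"
          using Z2 R \<open>0 < p\<close> by (intro powr_mono2) auto
        then show "(\<integral>\<^sup>+x. ennreal (\<bar>s x - P j x\<bar> powr p) \<partial>cube_measure) \<le> ennreal (Z powr p)"
          using P_int[of j] by (meson ennreal_leI order.trans)
      qed (use \<open>0 < p\<close> in auto)
      also have "2 powr p * (Z powr p + Z powr p) = (2 * 2 powr (1 / p) * Z) powr p"
        using Z \<open>0 < p\<close> by (simp add: powr_mult powr_powr)
      also have "2 * 2 powr (1 / p) * Z = c1 * R * 2 powr (- (real j * \<mu>))"
        by (simp add: Z_def c1_def)
      finally show ?thesis by (simp add: w_def A_def)
    qed
    define j0 where "j0 = nat \<lfloor>real k * H / \<mu>\<rfloor>"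
    \<comment> \<open>The minimum respects the constraint that no leaf is finer than
      \<open>J\<close>. If \<open>J \<le> j0\<close>, the tree is the uniform partition of level
      \<open>J\<close>.\<close>
    define i0 where "i0 = min j0 J"
    define kd where "kd = real (k * CARD('n))"
    have j0: "real j0 * a \<le> kd" "2 powr (- (real j0 * \<mu>)) \<le> 2 powr \<mu> * 2 powr (- (real k * H))"
      using floor_scale_bounds[of \<sigma> k, OF \<sigma>] by (simp_all add: j0_def \<mu>_def H_def a_def kd_def)
    \<comment> \<open>Threshold relative to the total bound \<open>A j\<close>, so at most
      \<open>1 / \<theta> j\<close> cells of a level \<open>j > 0\<close> are large. The value 1
      above \<open>J\<close> makes every cell small there, as a local integral never exceeds the
      total.\<close>
    define \<theta> where "\<theta> j = (if j \<le> J then K * 2 powr ((real j - real j0) * \<eta> - kd) else 1)" for j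
    have \<theta>: "0 < \<theta> j" for j using K by (simp add: \<theta>_def)
    define \<Lambda> where "\<Lambda> j = {I \<in> D j. ennreal (A j * \<theta> j)
        < (\<integral>\<^sup>+x. ennreal (\<bar>w j x\<bar> powr p) * indicator I x \<partial>cube_measure)}" for j
    have \<Lambda>_sub: "\<Lambda> j \<subseteq> cell j ` cbox 0 1" for j by (auto simp: \<Lambda>_def D)
    have \<Lambda>_card: "real (card (\<Lambda> j)) * \<theta> j \<le> 1" if "0 < j" for j
    proof -
      have "real (card (\<Lambda> j)) * (A j * \<theta> j) \<le> A j"
        unfolding \<Lambda>_def using D_props[of j] D_sets[of j] w_int[OF that] A[of j] \<theta>[of j]
        by (intro card_large_integral_le) (auto dest: partition_onD2)
      then show ?thesis using A[of j] by (simp add: field_simps)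
    qed
    have \<Lambda>_empty: "\<Lambda> j = {}" if "J < j" for j
    proof -
      have "(\<integral>\<^sup>+x. ennreal (\<bar>w j x\<bar> powr p) * indicator I x \<partial>cube_measure) \<le> ennreal (A j * \<theta> j)" for I
      proof -
        have "(\<integral>\<^sup>+x. ennreal (\<bar>w j x\<bar> powr p) * indicator I x \<partial>cube_measure)
            \<le> (\<integral>\<^sup>+x. ennreal (\<bar>w j x\<bar> powr p) \<partial>cube_measure)"
          by (intro nn_integral_mono) (auto split: split_indicator)
        with w_int[of j] that show ?thesis by (simp add: \<theta>_def)
      qed
      then show ?thesis by (simp add: \<Lambda>_def not_less)
    qed
    obtain lf where part: "partition_on (cbox 0 1) ((\<lambda>x. cell (lf x) x) ` cbox 0 1)"
      and fin: "finite ((\<lambda>x. cell (lf x) x) ` cbox 0 1)"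
      and card: "card ((\<lambda>x. cell (lf x) x) ` cbox 0 1)
          \<le> card (cell i0 ` cbox 0 1) + (\<Sum>j\<in>{i0<..J}. (j - i0) * (card (\<Lambda> j) * 2 ^ CARD('n)))"
      and lf: "\<And>x. x \<in> cbox 0 1 \<Longrightarrow> i0 \<le> lf x \<and> lf x \<le> J"
      and lf_eq: "\<And>x y. x \<in> cbox 0 1 \<Longrightarrow> y \<in> cell (lf x) x \<Longrightarrow> lf y = lf x"
      and lf_\<Lambda>: "\<And>x j. x \<in> cbox 0 1 \<Longrightarrow> lf x < j \<Longrightarrow> j \<le> J \<Longrightarrow> cell j x \<notin> \<Lambda> j"
    proof (rule tree_partition[of "cbox 0 1" cell "2 ^ CARD('n)" \<Lambda> i0 J])
      show "cell (Suc i) x \<subseteq> cell i x" for i x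
        unfolding cell_def by (rule dyadic_cell_mono) (rule aniso_level_Suc[of \<sigma>, OF \<sigma>])
      show "card (cell (Suc i) ` cell i x) \<le> 2 ^ CARD('n)" for i x
        unfolding cell_def by (rule card_dyadic_children) (rule aniso_level_Suc[of \<sigma>, OF \<sigma>])+
      show "finite (cell i ` cbox 0 1)" for i using D_props(1)[of i] by (simp add: D)
      show "x \<in> cell i x" if "x \<in> cbox 0 1" for i x using that by (simp add: cell_def dyadic_cell_self)
      show "cell i x \<subseteq> cbox 0 1" for i x unfolding cell_def by (rule dyadic_cell_subset)
      show "cell i y = cell i x" if "y \<in> cell i x" for i x y using that unfolding cell_def by (rule dyadic_cell_eq)
      show "\<Lambda> j \<subseteq> cell j ` cbox 0 1" for j by (rule \<Lambda>_sub)
      show "i0 \<le> J" by (simp add: i0_def)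
    qed (rule that)
    define m where "m = (\<lambda>x. cell (lf x) x) ` cbox 0 1"
    \<comment> \<open>Since \<open>lf\<close> is constant on each leaf, \<open>t\<close> coincides
      on it with a single \<open>P i\<close>, where the leaf is a cell of the partition carrying
      \<open>P i\<close>.\<close>
    define t where "t x = P (lf x) x" for x
    have m_sub: "m \<subseteq> (\<Union>i\<le>J. aniso_partition \<sigma> i)"
      using lf by (force simp: m_def D[unfolded D_def])
    have t_poly: "t \<in> piecewise_poly r m"
      unfolding piecewise_poly_iff
    proof
      fix I assume "I \<in> m"
      then obtain x where x: "x \<in> cbox 0 1" "I = cell (lf x) x" by (auto simp: m_def)
      then have "I \<in> D (lf x)" by (auto simp: D)
      then obtain g where "g \<in> box_polynomials r" "\<forall>y\<in>I. P (lf x) y = g y"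
        using P[of "lf x"] by (auto simp: piecewise_poly_iff)
      then show "\<exists>g\<in>box_polynomials r. \<forall>y\<in>I. t y = g y"
        using lf_eq[OF x(1)] by (auto simp: t_def x(2))
    qed
    have t_meas [measurable]: "t \<in> borel_measurable cube_measure"
    proof (rule borel_measurable_piecewise_poly[OF t_poly])
      show "m \<subseteq> sets borel" unfolding m_def cell_def using dyadic_cell_borel by auto
    qed (use part fin in \<open>simp_all add: m_def\<close>)
    have card_m: "real (card m) \<le> 2 * 2 ^ (k * CARD('n))"
    proof -
      \<comment> \<open>Leaves caused by large cells. The sum is empty when
        \<open>J \<le> j0\<close>; otherwise \<open>i0 = j0\<close> and the thresholds give a series
        in \<open>z\<close> that \<open>K\<close> normalizes.\<close>
      have "(\<Sum>j\<in>{i0<..J}. real (j - i0) * (real (card (\<Lambda> j)) * 2 ^ CARD('n))) \<le> 2 ^ (k * CARD('n))"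
      proof (cases "j0 < J")
        case False
        then show ?thesis by (simp add: i0_def)
      next
        case True
        then have i0: "i0 = j0" by (simp add: i0_def)
        have "(\<Sum>j\<in>{j0<..J}. real (j - j0) * (real (card (\<Lambda> j)) * 2 ^ CARD('n)))
            \<le> (\<Sum>j\<in>{j0<..J}. 2 ^ CARD('n) * 2 powr kd / K * (real (j - j0) * z ^ (j - j0)))"
        proof (intro sum_mono)
          fix j assume j: "j \<in> {j0<..J}"
          have "z ^ (j - j0) = 2 powr (- \<eta> * real (j - j0))"
            using z by (simp add: z_def powr_powr flip: powr_realpow)
          then have zj: "z ^ (j - j0) = 2 powr (- ((real j - real j0) * \<eta>))"
            using j by (simp add: of_nat_diff mult.commute)
          have "real (card (\<Lambda> j)) \<le> 1 / \<theta> j" using \<Lambda>_card[of j] j \<theta>[of j] by (simp add: field_simps)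
          also have "\<dots> = 2 powr kd / K * z ^ (j - j0)"
          proof -
            have "\<theta> j = K * (2 powr ((real j - real j0) * \<eta>) / 2 powr kd)"
              using j by (simp add: \<theta>_def powr_diff)
            then show ?thesis unfolding zj powr_minus by (simp add: inverse_eq_divide mult.commute)
          qed
          finally have "real (j - j0) * (real (card (\<Lambda> j)) * 2 ^ CARD('n))
              \<le> real (j - j0) * (2 powr kd / K * z ^ (j - j0) * 2 ^ CARD('n))"
            by (intro mult_left_mono mult_right_mono) auto
          then show "real (j - j0) * (real (card (\<Lambda> j)) * 2 ^ CARD('n))
              \<le> 2 ^ CARD('n) * 2 powr kd / K * (real (j - j0) * z ^ (j - j0))"
            by (simp add: mult_ac)
        qed
        also have "\<dots> \<le> 2 ^ CARD('n) * 2 powr kd / K * (1 / (1 - z)\<^sup>2)"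
          unfolding sum_distrib_left[symmetric] using z K
          by (intro mult_left_mono sum_mult_power_le) auto
        also have "\<dots> = 2 powr kd" using z by (simp add: K_def)
        finally show ?thesis by (simp only: i0 kd_def powr_realpow zero_less_numeral)
      qed
      moreover have "real (card (cell i0 ` cbox 0 1)) \<le> 2 ^ (k * CARD('n))"
        using card_aniso_partition_coarse_le[of \<sigma> i0 k, OF \<sigma>]
        by (simp add: D[unfolded D_def, symmetric] i0_def j0_def H_def \<mu>_def)
      moreover have "real (card m) \<le> real (card (cell i0 ` cbox 0 1)
          + (\<Sum>j\<in>{i0<..J}. (j - i0) * (card (\<Lambda> j) * 2 ^ CARD('n))))"
        unfolding m_def using card by (rule of_nat_mono)
      then have "real (card m) \<le> real (card (cell i0 ` cbox 0 1))
          + (\<Sum>j\<in>{i0<..J}. real (j - i0) * (real (card (\<Lambda> j)) * 2 ^ CARD('n)))"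
        by (simp only: of_nat_add of_nat_sum of_nat_mult of_nat_power of_nat_numeral)
      ultimately show ?thesis by linarith
    qed
    \<comment> \<open>The increment restricted to small cells. It has a supremum bound from the
      threshold, and it equals \<open>\<bar>w j x\<bar>\<close> at every level finer than the leaf
      of \<open>x\<close>.\<close>
    define g where "g j x = \<bar>w j x\<bar> * indicator (- \<Union>(\<Lambda> j)) x" for j x
    have \<Lambda>_borel: "\<Union>(\<Lambda> j) \<in> sets borel" for j
    proof (rule sets.finite_Union)
      show "finite (\<Lambda> j)" "\<Lambda> j \<subseteq> sets borel" using D_props[of j] by (auto simp: \<Lambda>_def)
    qed
    have g_meas [measurable]: "g j \<in> borel_measurable cube_measure" for j
    proof -
      have "(indicator (- \<Union>(\<Lambda> j)) :: real ^ 'n \<Rightarrow> real) \<in> borel_measurable borel"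
        using \<Lambda>_borel[of j] by (intro borel_measurable_indicator) (rule borel_comp)
      then have [measurable]: "(indicator (- \<Union>(\<Lambda> j)) :: real ^ 'n \<Rightarrow> real) \<in> borel_measurable cube_measure"
        by (rule borel_measurable_cube)
      show ?thesis unfolding g_def[abs_def] by measurable
    qed
    define b where "b j = 2 powr (- (real j * \<mu>)) * (2 powr (real j * a) * \<theta> j) powr \<delta>" for j
    have b: "0 < b j" for j using \<theta>[of j] by (simp add: b_def)
    have g_norm: "Lp_norm cube_measure q (g j) \<le> ennreal (c * R * b j)" if "0 < j" for j
    proof -
      \<comment> \<open>The polynomial constant, a bound for the inverse cell volume, and the
        largest local integral allowed on a small cell.\<close>
      define S where "S = (CP * 2 powr (real j * a) * \<theta> j) * A j"
      have S: "0 < S" using CP0 \<theta>[of j] A[of j] by (simp add: S_def)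
      have sup: "\<bar>g j x\<bar> powr p \<le> S" if x: "x \<in> cbox 0 1" for x
      proof (cases "x \<in> \<Union>(\<Lambda> j)")
        case True
        then show ?thesis using S by (simp add: g_def)
      next
        case False
        have xc: "x \<in> cell j x" using x by (simp add: cell_def dyadic_cell_self)
        have "cell j x \<in> D j" using x by (simp add: D)
        moreover have "cell j x \<notin> \<Lambda> j" using False xc by auto
        ultimately have I: "(\<integral>\<^sup>+y. ennreal (\<bar>w j y\<bar> powr p) * indicator (cell j x) y \<partial>cube_measure) \<le> ennreal (A j * \<theta> j)"
          by (simp add: \<Lambda>_def not_less)
        obtain f1 where f1: "f1 \<in> box_polynomials r" "\<forall>y\<in>cell j x. P j y = f1 y"
          using P[of j] \<open>cell j x \<in> D j\<close> by (auto simp: piecewise_poly_iff)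
        have "cell (j - 1) x \<in> D (j - 1)" using x by (simp add: D)
        then obtain f2 where f2: "f2 \<in> box_polynomials r" "\<forall>y\<in>cell (j - 1) x. P (j - 1) y = f2 y"
          using P[of "j - 1"] by (auto simp: piecewise_poly_iff)
        \<comment> \<open>By nesting, both \<open>P j\<close> and \<open>P (j - 1)\<close> are
          single polynomials on \<open>cell j x\<close>, and hence so is their difference.\<close>
        have "cell j x \<subseteq> cell (j - 1) x"
          unfolding cell_def using aniso_level_Suc(1)[of \<sigma> "j - 1", OF \<sigma>] \<open>0 < j\<close>
          by (intro dyadic_cell_mono) simp
        then have w_eq: "\<forall>y\<in>cell j x. w j y = f1 y - f2 y" using f1 f2 by (auto simp: w_def)
        have "ennreal (\<bar>w j x\<bar> powr p) \<le> ennreal (CP * 2 ^ (\<Sum>l\<in>UNIV. aniso_level \<sigma> j l))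
            * (\<integral>\<^sup>+y. ennreal (\<bar>w j y\<bar> powr p) * indicator (cell j x) y \<partial>cube_measure)"
          unfolding cell_def
          by (rule CP[OF box_polynomials_diff[OF f1(1) f2(1)] x]) (use w_eq in \<open>simp add: cell_def\<close>)
        also have "\<dots> \<le> ennreal (CP * 2 powr (real j * a)) * ennreal (A j * \<theta> j)"
          using I CP0 sum_aniso_level_le[of \<sigma> j, OF \<sigma>]
          by (intro mult_mono ennreal_leI mult_left_mono) (auto simp: a_def)
        also have "\<dots> = ennreal S" using CP0 A[of j] \<theta>[of j] by (simp add: S_def mult_ac flip: ennreal_mult)
        finally have "\<bar>w j x\<bar> powr p \<le> S" using S by (simp add: ennreal_le_iff)
        then show ?thesis using S by (simp add: g_def split: split_indicator)
      qed
      have "Lp_norm cube_measure q (g j) \<le> ennreal (S powr (1 / p - enn2real (1 / q)) * A j powr enn2real (1 / q))"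
      proof (rule Lp_norm_interpolation)
        show "(\<integral>\<^sup>+x. ennreal (\<bar>g j x\<bar> powr p) \<partial>cube_measure) \<le> ennreal (A j)"
          by (rule order.trans[OF nn_integral_mono w_int[OF that]]) (simp add: g_def split: split_indicator)
      qed (use assms S A sup in auto)
      \<comment> \<open>The two exponents of \<open>A j\<close> add up to \<open>1 / p\<close>,
        which undoes the \<open>p\<close>-th power in its definition.\<close>
      also have "S powr (1 / p - enn2real (1 / q)) * A j powr enn2real (1 / q)
          = (CP * (2 powr (real j * a) * \<theta> j)) powr \<delta> * (A j powr \<delta> * A j powr e)"
        using CP0 A[of j] \<theta>[of j] by (simp add: S_def \<delta>_def e_def powr_mult mult_ac)
      also have "A j powr \<delta> * A j powr e = c1 * R * 2 powr (- (real j * \<mu>))"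
      proof -
        have "A j powr \<delta> * A j powr e = A j powr (1 / p)" by (simp add: \<delta>_def flip: powr_add)
        then show ?thesis using \<open>0 < p\<close> c1 R by (simp add: A_def powr_powr)
      qed
      also have "(CP * (2 powr (real j * a) * \<theta> j)) powr \<delta> * (c1 * R * 2 powr (- (real j * \<mu>))) = c * R * b j"
        using CP0 \<theta>[of j] by (simp add: c_def b_def powr_mult mult_ac)
      finally show ?thesis .
    qed
    \<comment> \<open>The integrals of \<open>\<bar>s x - P j x\<bar> powr p\<close> decay
      geometrically in \<open>j\<close>, hence are summable for every \<open>p > 0\<close>. This
      identifies the limit of the telescoping sums almost everywhere.\<close>
    have lim: "AE x in cube_measure. (\<lambda>n. P (J + n) x - t x) \<longlonglongrightarrow> s x - t x"
    proof -
      define y where "y = 2 powr (- (\<mu> * p))"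
      have y: "0 < y" "y < 1" using \<mu> \<open>0 < p\<close> powr_less_mono[of "- (\<mu> * p)" 0 "2::real"] by (simp_all add: y_def)
      have "(\<Sum>j. \<integral>\<^sup>+x. ennreal (\<bar>s x - P j x\<bar> powr p) \<partial>cube_measure) \<le> (\<Sum>j. ennreal ((2 * R) powr p * y ^ j))"
      proof (intro suminf_le allI)
        fix j
        have "(2 * R * 2 powr (- (real j * \<mu>))) powr p = (2 * R) powr p * y ^ j"
          using R by (simp add: y_def powr_mult powr_powr mult_ac flip: powr_realpow)
        then show "(\<integral>\<^sup>+x. ennreal (\<bar>s x - P j x\<bar> powr p) \<partial>cube_measure) \<le> ennreal ((2 * R) powr p * y ^ j)"
          using P_int[of j] by simp
      qed auto
      also have "\<dots> < \<infinity>"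
        using y by (subst suminf_ennreal2) (auto intro!: summable_mult summable_geometric)
      finally have "AE x in cube_measure. (\<lambda>j. s x - P j x) \<longlonglongrightarrow> 0"
        using \<open>0 < p\<close> by (intro AE_tendsto_0_if_summable_powr) auto
      then show ?thesis
      proof eventually_elim
        case (elim x)
        from tendsto_diff[OF tendsto_const[of "s x"] elim] have "(\<lambda>j. P j x) \<longlonglongrightarrow> s x" by simp
        then have "(\<lambda>n. P (J + n) x) \<longlonglongrightarrow> s x"
          using LIMSEQ_ignore_initial_segment[of _ _ J] by (simp add: add.commute)
        then show ?case by (intro tendsto_diff tendsto_const)
      qed
    qed
    \<comment> \<open>The approximating sequence starts at level \<open>J\<close>, which is at least
      every leaf level, so telescoping down to the leaf is always possible. The sum then has
      \<open>J - i0 + n\<close> levels above \<open>i0\<close>.\<close>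
    have "Lp_norm cube_measure q (\<lambda>x. s x - t x) \<le> ennreal (c * R * (B1 * 2 powr (- (real j0 * \<mu>)) + B2 * 2 powr (- (real J * \<beta>))))"
    proof (rule Lp_norm_limit_le[where u = "\<lambda>n x. P (J + n) x - t x" and g = "\<lambda>j. g (Suc (i0 + j))"
          and b = "\<lambda>j. c * R * b (Suc (i0 + j))" and N = "\<lambda>n. J - i0 + n"])
      show "AE x in cube_measure. (\<lambda>n. P (J + n) x - t x) \<longlonglongrightarrow> s x - t x" by (rule lim)
      fix n :: nat and x :: "real ^ 'n"
      assume "x \<in> space cube_measure"
      then have x: "x \<in> cbox 0 1" by simp
      \<comment> \<open>A large cell at \<open>x\<close> finer than the leaf is excluded by the tree
        for \<open>j \<le> J\<close>, and by the threshold 1 for larger \<open>j\<close>.\<close>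
      have gw: "g j x = \<bar>w j x\<bar>" if "lf x < j" for j
      proof -
        have "x \<notin> \<Union>(\<Lambda> j)"
        proof
          assume "x \<in> \<Union>(\<Lambda> j)"
          then obtain I where I: "I \<in> \<Lambda> j" "x \<in> I" by blast
          then obtain y where "I = cell j y" using \<Lambda>_sub[of j] by auto
          then have "I = cell j x" using I(2) dyadic_cell_eq unfolding cell_def by metis
          moreover have "j \<le> J" using I(1) \<Lambda>_empty[of j] by (auto simp: not_less[symmetric])
          ultimately show False using lf_\<Lambda>[OF x that] I(1) by simp
        qed
        then show ?thesis by (simp add: g_def)
      qed
      have "\<bar>P (J + n) x - t x\<bar> \<le> (\<Sum>j\<in>{lf x<..J + n}. \<bar>w j x\<bar>)"
        using telescope_abs_le[of "lf x" "J + n" "\<lambda>j. P j x"] lf[OF x] by (simp add: t_def w_def)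
      also have "\<dots> = (\<Sum>j\<in>{lf x<..J + n}. g j x)" using gw by (intro sum.cong) auto
      \<comment> \<open>Adding nonnegative terms down to \<open>i0\<close> makes the range of levels
        independent of \<open>x\<close>.\<close>
      also have "\<dots> \<le> (\<Sum>j\<in>{i0<..J + n}. g j x)"
        using lf[OF x] by (intro sum_mono2) (auto simp: g_def)
      also have "\<dots> = (\<Sum>j<J - i0 + n. g (Suc (i0 + j)) x)"
        by (rule sum.reindex_bij_witness[of _ "\<lambda>j. Suc (i0 + j)" "\<lambda>j. j - Suc i0"])
           (auto simp: i0_def)
      finally show "\<bar>P (J + n) x - t x\<bar> \<le> (\<Sum>j<J - i0 + n. g (Suc (i0 + j)) x)" .
    next
      fix n
      have "(\<Sum>j<n. b (Suc (i0 + j))) \<le> B1 * 2 powr (- (real j0 * \<mu>)) + B2 * 2 powr (- (real J * \<beta>))"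
        unfolding B1_def B2_def b_def \<theta>_def \<eta>_def i0_def
        by (rule threshold_sum_le[OF \<delta>(2) \<open>0 < \<beta>\<close> \<delta>(1) K j0(1)])
      then show "(\<Sum>j<n. c * R * b (Suc (i0 + j))) \<le> c * R * (B1 * 2 powr (- (real j0 * \<mu>)) + B2 * 2 powr (- (real J * \<beta>)))"
        unfolding sum_distrib_left[symmetric] using c R by (intro mult_left_mono) auto
    qed (use \<open>1 \<le> q\<close> c R b g_norm in \<open>auto simp: g_def\<close>)
    also have "\<dots> \<le> ennreal (C * R * (2 powr (- (real J * \<beta>)) + 2 powr (- (real k * H))))"
    proof (rule ennreal_leI)
      have "B1 * 2 powr (- (real j0 * \<mu>)) + B2 * 2 powr (- (real J * \<beta>))
          \<le> B1 * (2 powr \<mu> * 2 powr (- (real k * H))) + B2 * 2 powr (- (real J * \<beta>))"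
        using j0(2) B by simp
      also have "\<dots> \<le> (B1 * 2 powr \<mu> + B2) * (2 powr (- (real J * \<beta>)) + 2 powr (- (real k * H)))"
        using B by (simp add: algebra_simps)
      finally have "c * R * (B1 * 2 powr (- (real j0 * \<mu>)) + B2 * 2 powr (- (real J * \<beta>)))
          \<le> c * R * ((B1 * 2 powr \<mu> + B2) * (2 powr (- (real J * \<beta>)) + 2 powr (- (real k * H))))"
        using c R by (intro mult_left_mono) auto
      then show "c * R * (B1 * 2 powr (- (real j0 * \<mu>)) + B2 * 2 powr (- (real J * \<beta>)))
          \<le> C * R * (2 powr (- (real J * \<beta>)) + 2 powr (- (real k * H)))"
        by (simp add: C_def mult_ac)
    qed
    finally have "approx_error r q m s \<le> ennreal (C * R * (2 powr (- (real J * \<beta>)) + 2 powr (- (real k * H))))"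
      unfolding approx_error_def using t_poly by (intro INF_lower2[of t]) auto
    then show "\<exists>m. finite m \<and> partition_on (cbox 0 1) m \<and> m \<subseteq> (\<Union>i\<le>J. aniso_partition \<sigma> i)
        \<and> real (card m) \<le> 2 * 2 ^ (k * CARD('n))
        \<and> approx_error r q m s \<le> ennreal (C * R * (2 powr (- (real J * \<beta>)) + 2 powr (- (real k * H))))"
      using fin part m_sub card_m by (intro exI[of _ m]) (auto simp: m_def)
  qed
qed

section \<open>The uniform construction for q <= p\<close>

text \<open>The cube has measure 1, so the L_p error already controls the L_q error up to a factor
  2, and the partition of level \<open>min j0 J\<close> suffices.\<close>

lemma uniform_approximation:
  fixes r :: "'n::finite \<Rightarrow> nat" and \<sigma> :: "'n \<Rightarrow> real" and p :: real and q :: ennreal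
  defines "\<mu> \<equiv> min_smoothness \<sigma>" and "H \<equiv> harmonic_mean \<sigma>"
  assumes \<sigma>: "\<And>l. 0 < \<sigma> l" and "1 \<le> q" "q \<le> ennreal p" and R: "0 < R" and s: "s \<in> borel_measurable cube_measure"
    and err: "\<And>j. approx_error r (ennreal p) (aniso_partition \<sigma> j) s \<le> ennreal (R * 2 powr (- (real j * \<mu>)))"
  shows "\<exists>m. finite m \<and> partition_on (cbox 0 1) m \<and> m \<subseteq> (\<Union>i\<le>J. aniso_partition \<sigma> i)
        \<and> real (card m) \<le> 2 * 2 ^ (k * CARD('n))
        \<and> approx_error r q m s \<le> ennreal (4 * 2 powr \<mu> * R * (2 powr (- (real J * \<mu>)) + 2 powr (- (real k * H))))"
proof -
  define j0 where "j0 = nat \<lfloor>real k * H / \<mu>\<rfloor>"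
  define i where "i = min j0 J"
  have \<mu>: "0 < \<mu>" unfolding \<mu>_def by (rule min_smoothness_pos[of \<sigma>, OF \<sigma>])
  have one: "1 \<le> (2::real) powr \<mu>" using \<mu> ge_one_powr_ge_zero[of 2 \<mu>] by simp
  have j0: "2 powr (- (real j0 * \<mu>)) \<le> 2 powr \<mu> * (2::real) powr (- (real k * H))"
    using floor_scale_bounds(2)[of \<sigma> k, OF \<sigma>] by (simp add: j0_def \<mu>_def H_def)
  obtain P where P: "\<And>j. P j \<in> piecewise_poly r (aniso_partition \<sigma> j)"
    "\<And>j. Lp_norm cube_measure (ennreal p) (\<lambda>x. s x - P j x) \<le> ennreal (2 * R * 2 powr (- (real j * \<mu>)))"
    using near_best_approximation[OF R, of r "ennreal p" "aniso_partition \<sigma>" s \<mu>] err by blast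
  have "P i \<in> borel_measurable cube_measure"
    by (rule borel_measurable_piecewise_poly[OF P(1) aniso_partition_measurable])
  then have "Lp_norm cube_measure q (\<lambda>x. s x - P i x) \<le> ennreal (2 * (2 * R * 2 powr (- (real i * \<mu>))))"
    using assms P(2)[of i] by (intro Lp_norm_le_finite_measure[where p = p, OF eq_refl[OF emeasure_cube]]) auto
  also have "\<dots> \<le> ennreal (4 * 2 powr \<mu> * R * (2 powr (- (real J * \<mu>)) + 2 powr (- (real k * H))))"
  proof (rule ennreal_leI)
    \<comment> \<open>Whichever of \<open>j0\<close> and \<open>J\<close> is the minimum, its decay
      is covered by one of the two terms.\<close>
    have "1 * 2 powr (- (real J * \<mu>)) \<le> 2 powr \<mu> * (2::real) powr (- (real J * \<mu>))"
      by (rule mult_right_mono[OF one]) simp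
    then have "2 powr (- (real i * \<mu>)) \<le> 2 powr \<mu> * (2::real) powr (- (real J * \<mu>)) + 2 powr \<mu> * 2 powr (- (real k * H))"
      using j0 by (cases "j0 \<le> J") (simp_all add: i_def min_def add_increasing add_increasing2)
    then have "4 * R * 2 powr (- (real i * \<mu>))
        \<le> 4 * R * (2 powr \<mu> * (2::real) powr (- (real J * \<mu>)) + 2 powr \<mu> * 2 powr (- (real k * H)))"
      using R by (intro mult_left_mono) auto
    then show "2 * (2 * R * 2 powr (- (real i * \<mu>)))
        \<le> 4 * 2 powr \<mu> * R * (2 powr (- (real J * \<mu>)) + 2 powr (- (real k * H)))"
      by (simp add: algebra_simps)
  qed
  finally have "approx_error r q (aniso_partition \<sigma> i) s
      \<le> ennreal (4 * 2 powr \<mu> * R * (2 powr (- (real J * \<mu>)) + 2 powr (- (real k * H))))"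
    unfolding approx_error_def using P(1)[of i] by (intro INF_lower2[of "P i"]) auto
  moreover have "real (card (aniso_partition \<sigma> i)) \<le> 2 * 2 ^ (k * CARD('n))"
  proof -
    have "real (card (aniso_partition \<sigma> i)) \<le> 2 ^ (k * CARD('n))"
      by (rule card_aniso_partition_coarse_le[OF \<sigma>]) (simp add: i_def j0_def \<mu>_def H_def)
    also have "\<dots> \<le> 2 * 2 ^ (k * CARD('n))" by simp
    finally show ?thesis .
  qed
  moreover have "aniso_partition \<sigma> i \<subseteq> (\<Union>i\<le>J. aniso_partition \<sigma> i)" by (rule UN_upper) (simp add: i_def)
  ultimately show ?thesis
    using aniso_partition_measurable(1,2)[of \<sigma> i] by blast
qed

section \<open>From smoothness balls to the theorem\<close>

text \<open>A single term of the supremum or of the series is at most the whole seminorm.\<close>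

lemma smoothness_ball_approx_error_le:
  assumes s: "s \<in> smoothness_ball r \<sigma> p p' R" and "0 < R" and p': "p' = \<infinity> \<or> (\<exists>p0>0. p' = ennreal p0)"
  shows "approx_error r p (aniso_partition \<sigma> k) s \<le> ennreal (R * 2 powr (- (real k * min_smoothness \<sigma>)))"
proof -
  define a where "a k = ennreal (2 powr (real k * min_smoothness \<sigma>)) * approx_error r p (aniso_partition \<sigma> k) s" for k
  have N: "smoothness_seminorm r \<sigma> p p' s = (if p' = \<infinity> then (SUP k. a k)
      else ennreal_powr (\<Sum>k. ennreal_powr (a k) (enn2real p')) (1 / enn2real p'))"
    by (simp add: smoothness_seminorm_def a_def[abs_def] Let_def)
  have N_le: "smoothness_seminorm r \<sigma> p p' s \<le> ennreal R" using s by (simp add: smoothness_ball_def)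
  have "a k \<le> ennreal R"
  proof (cases "p' = \<infinity>")
    case True
    have "a k \<le> smoothness_seminorm r \<sigma> p p' s" unfolding N if_P[OF True] by (rule SUP_upper) simp
    with N_le show ?thesis by simp
  next
    case False
    then obtain p0 where p0: "0 < p0" "p' = ennreal p0" using p' by auto
    have "smoothness_seminorm r \<sigma> p p' s = ennreal_powr (\<Sum>k. ennreal_powr (a k) p0) (1 / p0)"
      unfolding N if_not_P[OF False] using p0 by simp
    with N_le have "(\<Sum>k. ennreal_powr (a k) p0) \<le> ennreal (R powr p0)"
      using p0 \<open>0 < R\<close> by (simp add: ennreal_powr_inverse_le_iff)
    moreover have "(\<Sum>j\<in>{k}. ennreal_powr (a j) p0) \<le> (\<Sum>k. ennreal_powr (a k) p0)"
      by (rule sum_le_suminf) auto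
    ultimately have le: "ennreal_powr (a k) p0 \<le> ennreal (R powr p0)" by simp
    show ?thesis
      using ennreal_powr_inverse_le_iff[of "1 / p0" "R powr p0" "a k"] le p0 \<open>0 < R\<close> by (simp add: powr_powr)
  qed
  then have "ennreal (2 powr (- (real k * min_smoothness \<sigma>))) * a k
      \<le> ennreal (2 powr (- (real k * min_smoothness \<sigma>))) * ennreal R"
    by (intro mult_left_mono) auto
  moreover have "ennreal (2 powr (- (real k * min_smoothness \<sigma>))) * a k = approx_error r p (aniso_partition \<sigma> k) s"
    by (simp add: a_def powr_minus flip: mult.assoc ennreal_mult)
  ultimately show ?thesis using \<open>0 < R\<close> by (simp add: mult.commute flip: ennreal_mult)
qed

text \<open>The requirements on \<open>m\<close> that do not involve \<open>s\<close> or
  \<open>R\<close>. They describe a finite family, so the error can be minimized over it.\<close>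

definition admissible_partitions :: "('n::finite \<Rightarrow> real) \<Rightarrow> nat \<Rightarrow> nat \<Rightarrow> (real ^ 'n) set set set" where
  "admissible_partitions \<sigma> J k = {m. partition_on (cbox 0 1) m \<and> m \<subseteq> (\<Union>i\<le>J. aniso_partition \<sigma> i)
      \<and> real (card m) \<le> 2 * 2 ^ (k * CARD('n))}"

lemma finite_admissible_partitions: "finite (admissible_partitions \<sigma> J k)"
  by (rule finite_subset[of _ "Pow (\<Union>i\<le>J. aniso_partition \<sigma> i)"])
     (auto simp: admissible_partitions_def aniso_partition_measurable(1))

lemma smoothness_ball_approximation:
  fixes r :: "'n::finite \<Rightarrow> nat" and \<sigma> :: "'n \<Rightarrow> real" and p :: real and q :: ennreal
  defines "\<mu> \<equiv> min_smoothness \<sigma>" and "H \<equiv> harmonic_mean \<sigma>" and "\<delta> \<equiv> max (1 / p - enn2real (1 / q)) 0"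
  assumes \<sigma>: "\<And>l. 0 < \<sigma> l" and p: "0 < p" and q: "1 \<le> q" and \<delta>: "\<delta> < H / real CARD('n)"
    and p': "p' = (if p \<le> 1 \<or> ennreal p \<ge> q then \<infinity> else ennreal p)"
  shows "\<exists>C>0. \<forall>J k R s. 0 < R \<longrightarrow> s \<in> smoothness_ball r \<sigma> (ennreal p) p' R \<longrightarrow>
     (\<exists>m\<in>admissible_partitions \<sigma> J k. approx_error r q m s \<le> ennreal (C * R *
        (2 powr (- (real J * real CARD('n) * (H / real CARD('n) - \<delta>) * \<mu> / H)) + 2 powr (- (real k * H)))))"
proof -
  have H: "0 < H" unfolding H_def by (rule harmonic_mean_pos[of \<sigma>, OF \<sigma>])
  have \<mu>: "0 < \<mu>" unfolding \<mu>_def by (rule min_smoothness_pos[of \<sigma>, OF \<sigma>])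
  \<comment> \<open>Since \<open>aniso_rate \<sigma>\<close> is \<open>CARD('n) * \<mu> / H\<close>,
    the exponent of the theorem is \<open>J\<close> times the \<open>\<beta>\<close> of the adaptive
    construction, or \<open>J * \<mu>\<close> when \<open>\<delta> = 0\<close>.\<close>
  have rate: "real J * real CARD('n) * (H / real CARD('n) - \<delta>) * \<mu> / H = real J * (\<mu> - aniso_rate \<sigma> * \<delta>)" for J
    using H unfolding aniso_rate_eq[of \<sigma>, OF \<sigma>] by (simp add: H_def \<mu>_def field_simps)
  have ball: "s \<in> borel_measurable cube_measure"
     "approx_error r (ennreal p) (aniso_partition \<sigma> j) s \<le> ennreal (R * 2 powr (- (real j * \<mu>)))"
    if "0 < R" "s \<in> smoothness_ball r \<sigma> (ennreal p) p' R" for s R j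
  proof -
    show "s \<in> borel_measurable cube_measure" using that(2) by (simp add: smoothness_ball_def Lp_cube_def)
    show "approx_error r (ennreal p) (aniso_partition \<sigma> j) s \<le> ennreal (R * 2 powr (- (real j * \<mu>)))"
      unfolding \<mu>_def using that(2,1) by (rule smoothness_ball_approx_error_le) (use p p' in auto)
  qed
  show ?thesis
  proof (cases "q \<le> ennreal p")
    case True
    obtain q' where q': "q = ennreal q'" "0 \<le> q'" using True by (cases q) (auto simp: top_unique)
    then have "1 \<le> q'" "q' \<le> p" using q True p by (auto simp: ennreal_1[symmetric] ennreal_le_iff2 simp del: ennreal_1)
    then have "1 / p - enn2real (1 / q) \<le> 0"
      using q' p by (simp add: divide_ennreal_def inverse_ennreal enn2real_mult inverse_eq_divide field_simps)
    then have "\<delta> = 0" by (simp add: \<delta>_def)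
    show ?thesis
    proof (rule exI[of _ "4 * 2 powr \<mu>"], intro conjI allI impI)
      fix J k :: nat and R s assume *: "0 < R" "s \<in> smoothness_ball r \<sigma> (ennreal p) p' R"
      show "\<exists>m\<in>admissible_partitions \<sigma> J k. approx_error r q m s \<le> ennreal (4 * 2 powr \<mu> * R *
          (2 powr (- (real J * real CARD('n) * (H / real CARD('n) - \<delta>) * \<mu> / H)) + 2 powr (- (real k * H))))"
      proof -
        have rate0: "real J * real CARD('n) * (H / real CARD('n) - \<delta>) * \<mu> / H = real J * \<mu>"
          unfolding rate by (simp add: \<open>\<delta> = 0\<close>)
        show ?thesis
          using uniform_approximation[of \<sigma> q p R s r J k, folded \<mu>_def H_def,
              OF \<sigma> q True *(1) ball(1)[OF *] ball(2)[OF *]]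
          unfolding rate0 admissible_partitions_def by blast
      qed
    qed simp
  next
    case False
    define e where "e = enn2real (1 / q)"
    have pq: "ennreal p \<le> q" using False by simp
    have "e < 1 / p"
    proof (cases q)
      case (real q')
      then have "p < q'" using False p by (auto simp: ennreal_le_iff2 not_le)
      then show ?thesis using p real
        by (simp add: e_def divide_ennreal_def inverse_ennreal enn2real_mult inverse_eq_divide field_simps)
    qed (use p in \<open>simp add: e_def\<close>)
    then have \<delta>_eq: "\<delta> = 1 / p - e" by (simp add: \<delta>_def e_def)
    have "aniso_rate \<sigma> * \<delta> < aniso_rate \<sigma> * (H / real CARD('n))"
      using \<delta> aniso_rate_pos[of \<sigma>, OF \<sigma>] by (rule mult_strict_left_mono)
    also have "\<dots> = \<mu>" using H unfolding aniso_rate_eq[of \<sigma>, OF \<sigma>] by (simp add: H_def \<mu>_def)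
    finally have \<beta>: "0 < \<mu> - aniso_rate \<sigma> * (1 / p - e)" by (simp add: \<delta>_eq)
    obtain C where "0 < C \<and> (\<forall>J k R s. 0 < R \<longrightarrow> s \<in> borel_measurable cube_measure \<longrightarrow>
      (\<forall>j. approx_error r (ennreal p) (aniso_partition \<sigma> j) s \<le> ennreal (R * 2 powr (- (real j * \<mu>)))) \<longrightarrow>
      (\<exists>m. finite m \<and> partition_on (cbox 0 1) m \<and> m \<subseteq> (\<Union>i\<le>J. aniso_partition \<sigma> i)
        \<and> real (card m) \<le> 2 * 2 ^ (k * CARD('n))
        \<and> approx_error r q m s \<le> ennreal (C * R * (2 powr (- (real J * (\<mu> - aniso_rate \<sigma> * (1 / p - e)))) + 2 powr (- (real k * H))))))"
      using adaptive_approximation[of \<sigma> p q r, folded \<mu>_def H_def e_def, OF \<sigma> p q pq \<open>e < 1 / p\<close> \<beta>] ..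
    note C0 = conjunct1[OF this] and C = conjunct2[OF this, rule_format]
    show ?thesis
    proof (rule exI[of _ C], intro conjI allI impI C0)
      fix J k :: nat and R s assume *: "0 < R" "s \<in> smoothness_ball r \<sigma> (ennreal p) p' R"
      show "\<exists>m\<in>admissible_partitions \<sigma> J k. approx_error r q m s \<le> ennreal (C * R *
          (2 powr (- (real J * real CARD('n) * (H / real CARD('n) - \<delta>) * \<mu> / H)) + 2 powr (- (real k * H))))"
      proof -
        have rate': "real J * real CARD('n) * (H / real CARD('n) - \<delta>) * \<mu> / H = real J * (\<mu> - aniso_rate \<sigma> * (1 / p - e))"
          unfolding rate by (simp add: \<delta>_eq)
        show ?thesis
          using C[OF *(1) ball(1)[OF *] ball(2)[OF *], of J k]
          unfolding rate' admissible_partitions_def by blast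
      qed
    qed
  qed
qed

theorem theorem2:
  shows "\<exists>(C1 :: ('n::finite \<Rightarrow> real) \<Rightarrow> real \<Rightarrow> real)
          (C3 :: ('n \<Rightarrow> nat) \<Rightarrow> ('n \<Rightarrow> real) \<Rightarrow> real \<Rightarrow> ennreal \<Rightarrow> real).
    (\<forall>\<sigma> p. C1 \<sigma> p > 0) \<and> (\<forall>r \<sigma> p q. C3 r \<sigma> p q > 0) \<and>
    (\<forall>(r :: 'n \<Rightarrow> nat) (J :: nat) (\<sigma> :: 'n \<Rightarrow> real) (p :: real) (q :: ennreal) (p' :: ennreal)
       (s :: real ^ 'n \<Rightarrow> real).
      (\<forall>l. 0 < \<sigma> l \<and> \<sigma> l < real (r l) + 1) \<longrightarrow>
      0 < p \<longrightarrow> 1 \<le> q \<longrightarrow>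
      harmonic_mean \<sigma> / real CARD('n) > max (1 / p - enn2real (1 / q)) 0 \<longrightarrow>
      p' = (if p \<le> 1 \<or> ennreal p \<ge> q then \<infinity> else ennreal p) \<longrightarrow>
      (\<exists>R>0. s \<in> smoothness_ball r \<sigma> (ennreal p) p' R) \<longrightarrow>
      (\<forall>k :: nat. \<exists>m :: (real ^ 'n) set set.
        finite m \<and> partition_on (cbox 0 1) m \<and>
        (\<forall>I\<in>m. \<exists>j. I \<in> dyadic_rectangles j \<and>
                 (\<forall>l. (1/2) ^ j l \<ge> 2 powr (- (real J * min_smoothness \<sigma> / \<sigma> l)))) \<and>
        real (card m) \<le> C1 \<sigma> p * 2 ^ (k * CARD('n)) \<and>
        (\<forall>R>0. s \<in> smoothness_ball r \<sigma> (ennreal p) p' R \<longrightarrow>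
          approx_error r q m s
            \<le> ennreal (C3 r \<sigma> p q * R *
                (2 powr (- (real J * real CARD('n)
                    * (harmonic_mean \<sigma> / real CARD('n) - max (1 / p - enn2real (1 / q)) 0)
                    * min_smoothness \<sigma> / harmonic_mean \<sigma>))
                 + 2 powr (- (real k * harmonic_mean \<sigma>)))))))"
proof -
  define rate where "rate \<sigma> p q J = real J * real CARD('n)
      * (harmonic_mean \<sigma> / real CARD('n) - max (1 / p - enn2real (1 / q)) 0)
      * min_smoothness \<sigma> / harmonic_mean \<sigma>" for \<sigma> :: "'n \<Rightarrow> real" and p :: real and q :: ennreal and J :: nat
  define p\<^sub>0 where "p\<^sub>0 p q = (if p \<le> 1 \<or> ennreal p \<ge> q then \<infinity> else ennreal p)" for p :: real and q :: ennreal
  \<comment> \<open>The parameter conditions are premises inside \<open>good\<close>, so a suitable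
    \<open>C\<close> exists for all arguments, with 1 as default value. The choice \<open>C3\<close>
    is therefore positive everywhere and depends only on \<open>r\<close>, \<open>\<sigma>\<close>,
    \<open>p\<close> and \<open>q\<close>.\<close>
  define good where "good r \<sigma> p q C \<longleftrightarrow> 0 < C \<and>
     ((\<forall>l. 0 < \<sigma> l) \<and> 0 < p \<and> 1 \<le> q \<and> max (1 / p - enn2real (1 / q)) 0 < harmonic_mean \<sigma> / real CARD('n) \<longrightarrow>
      (\<forall>J k R s. 0 < R \<longrightarrow> s \<in> smoothness_ball r \<sigma> (ennreal p) (p\<^sub>0 p q) R \<longrightarrow>
       (\<exists>m\<in>admissible_partitions \<sigma> J k. approx_error r q m s
          \<le> ennreal (C * R * (2 powr (- rate \<sigma> p q J) + 2 powr (- (real k * harmonic_mean \<sigma>)))))))"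
    for r :: "'n \<Rightarrow> nat" and \<sigma> :: "'n \<Rightarrow> real" and p :: real and q :: ennreal and C :: real
  define C3 where "C3 r \<sigma> p q = (SOME C. good r \<sigma> p q C)" for r :: "'n \<Rightarrow> nat" and \<sigma> p q
  have "\<exists>C. good r \<sigma> p q C" for r \<sigma> p q
  proof (cases "(\<forall>l. 0 < \<sigma> l) \<and> 0 < p \<and> 1 \<le> q \<and> max (1 / p - enn2real (1 / q)) 0 < harmonic_mean \<sigma> / real CARD('n)")
    case True
    then show ?thesis
      using smoothness_ball_approximation[of \<sigma> p q "p\<^sub>0 p q" r] unfolding good_def rate_def p\<^sub>0_def by simp
  next
    case False
    then show ?thesis unfolding good_def by (intro exI[of _ 1]) auto
  qed
  then have C3: "good r \<sigma> p q (C3 r \<sigma> p q)" for r \<sigma> p q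
    unfolding C3_def by (rule someI_ex)
  show ?thesis
  proof (rule exI[of _ "\<lambda>_ _. 2"], rule exI[of _ C3], intro conjI allI impI)
    show "0 < C3 r \<sigma> p q" for r \<sigma> p q using C3[of r \<sigma> p q] by (simp add: good_def)
  next
    fix r :: "'n \<Rightarrow> nat" and J k :: nat and \<sigma> p q p' and s :: "real ^ 'n \<Rightarrow> real"
    assume \<sigma>: "\<forall>l. 0 < \<sigma> l \<and> \<sigma> l < real (r l) + 1" and p: "0 < p" and q: "1 \<le> q"
      and H: "max (1 / p - enn2real (1 / q)) 0 < harmonic_mean \<sigma> / real CARD('n)"
      and p': "p' = (if p \<le> 1 \<or> ennreal p \<ge> q then \<infinity> else ennreal p)"
      and ball: "\<exists>R>0. s \<in> smoothness_ball r \<sigma> (ennreal p) p' R"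
    have \<sigma>': "\<And>l. 0 < \<sigma> l" using \<sigma> by blast
    have approx: "\<exists>m\<in>admissible_partitions \<sigma> J k. approx_error r q m s
          \<le> ennreal (C3 r \<sigma> p q * R * (2 powr (- rate \<sigma> p q J) + 2 powr (- (real k * harmonic_mean \<sigma>))))"
      if "0 < R" "s \<in> smoothness_ball r \<sigma> (ennreal p) p' R" for R
      using C3[of r \<sigma> p q] that \<sigma>' p q H unfolding good_def p\<^sub>0_def p' by blast
    \<comment> \<open>Since \<open>m\<close> may not depend on \<open>R\<close>, take a minimizer of the error among the finitely many candidates.\<close>
    let ?E = "\<lambda>m. approx_error r q m s"
    have "?E ` admissible_partitions \<sigma> J k \<noteq> {}" using ball approx by blast
    then have "Min (?E ` admissible_partitions \<sigma> J k) \<in> ?E ` admissible_partitions \<sigma> J k"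
      by (intro Min_in finite_imageI finite_admissible_partitions)
    then obtain m where m: "m \<in> admissible_partitions \<sigma> J k" "?E m = Min (?E ` admissible_partitions \<sigma> J k)"
      by auto
    have min: "?E m \<le> ?E m'" if "m' \<in> admissible_partitions \<sigma> J k" for m'
      unfolding m(2) using that by (intro Min_le finite_imageI finite_admissible_partitions) auto
    have "\<exists>j. I \<in> dyadic_rectangles j \<and> (\<forall>l. (1/2) ^ j l \<ge> 2 powr (- (real J * min_smoothness \<sigma> / \<sigma> l)))" if "I \<in> m" for I
    proof -
      have "m \<subseteq> (\<Union>i\<le>J. aniso_partition \<sigma> i)" using m(1) by (simp add: admissible_partitions_def)
      then have "I \<in> (\<Union>i\<le>J. aniso_partition \<sigma> i)" using that by (rule subsetD)
      then obtain i where i: "i \<le> J" "I \<in> dyadic_rectangles (aniso_level \<sigma> i)"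
        unfolding aniso_partition_eq by (elim UN_E) simp
      then show ?thesis
        by (intro exI[of _ "aniso_level \<sigma> i"] conjI allI aniso_level_sidelength[of \<sigma> i J, OF \<sigma>'])
    qed
    moreover have "?E m \<le> ennreal (C3 r \<sigma> p q * R * (2 powr (- rate \<sigma> p q J) + 2 powr (- (real k * harmonic_mean \<sigma>))))"
      if "0 < R" "s \<in> smoothness_ball r \<sigma> (ennreal p) p' R" for R
      using approx[OF that] min by (meson order.trans)
    moreover have "finite m"
    proof (rule finite_subset)
      show "m \<subseteq> (\<Union>i\<le>J. aniso_partition \<sigma> i)" using m(1) by (simp add: admissible_partitions_def)
    qed (intro finite_UN_I finite_atMost aniso_partition_measurable(1))
    ultimately show "\<exists>m. finite m \<and> partition_on (cbox 0 1) m \<and>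
        (\<forall>I\<in>m. \<exists>j. I \<in> dyadic_rectangles j \<and>
                 (\<forall>l. (1/2) ^ j l \<ge> 2 powr (- (real J * min_smoothness \<sigma> / \<sigma> l)))) \<and>
        real (card m) \<le> 2 * 2 ^ (k * CARD('n)) \<and>
        (\<forall>R>0. s \<in> smoothness_ball r \<sigma> (ennreal p) p' R \<longrightarrow>
          approx_error r q m s
            \<le> ennreal (C3 r \<sigma> p q * R *
                (2 powr (- (real J * real CARD('n)
                    * (harmonic_mean \<sigma> / real CARD('n) - max (1 / p - enn2real (1 / q)) 0)
                    * min_smoothness \<sigma> / harmonic_mean \<sigma>))
                 + 2 powr (- (real k * harmonic_mean \<sigma>)))))"
      using m(1) unfolding admissible_partitions_def rate_def by (intro exI[of _ m]) blast
  qed simp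
qed

end
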